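(* Let $k,\rho,C_p,\Delta H^*>0$, $T_m\in\mathbb{R}$, $\alpha=\frac{k}{\rho C_p}$, $\beta=\frac{k}{\rho\Delta H^*}$. Let $c>0$ be an arbitrary controller gain, and consider the closed-loop system consisting of the one-phase Stefan problem $$T_t(x,t)=\alpha T_{xx}(x,t)\quad (0<x<s(t),\ t>0),$$ $$-kT_x(0,t)=q_c(t),\qquad T(s(t),t)=T_m,\qquad \dot s(t)=-\beta T_x(s(t),t),$$ $$T(x,0)=T_0(x)\ (0\le x\le s_0),\qquad s(0)=s_0>0,$$ and the control law $$q_c(t)=-ck\left(\frac1\alpha\int_0^{s(t)}\bigl(T(x,t)-T_m\bigr)\,dx+\frac1\beta\bigl(s(t)-s_r\bigr)\right).$$ Assume that the initial condition $(T_0,s_0)$ is compatible with the control law and that there is a constant $H>0$ with $$0\le T_0(x)-T_m\le H(s_0-x)\quad\text{for all }x\in[0,s_0].$$ Then, for any reference setpoint $s_r$ satisfying $$s_r>s_0+\frac{C_p}{\Delta H^*}\int_0^{s_0}\bigl(T_0(x)-T_m\bigr)\,dx,$$ the closed-loop system is exponentially stable in the sense of the norm $$\|T-T_m\|_{\mathcal H_1}^2+(s(t)-s_r)^2 ,$$ that is, there exist constants $D>0$ and $b>0$ such that for all $t\ge0$ $$\|T(\cdot,t)-T_m\|_{\mathcal H_1}^2+(s(t)-s_r)^2\le D\left(\|T_0-T_m\|_{\mathcal H_1}^2+(s_0-s_r)^2\right)e^{-bt}.$$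
   Context: The system models melting in one dimension: $T(x,t)$ is the temperature of the liquid phase occupying $[0,s(t)]$, $s(t)$ is the unknown liquid-solid interface, $T_m$ is the melting temperature, $q_c(t)$ is the manipulated heat flux at $x=0$, and $\rho, C_p, k, \Delta H^*$ are the density, heat capacity, heat conductivity and latent heat of fusion. The norm at time $t$ is $\|T(\cdot,t)-T_m\|_{\mathcal H_1}^2=\int_0^{s(t)}(T(x,t)-T_m)^2dx+\int_0^{s(t)}T_x(x,t)^2dx$; at $t=0$ it is $\|T_0-T_m\|_{\mathcal H_1}^2=\int_0^{s_0}(T_0(x)-T_m)^2dx+\int_0^{s_0}T_0'(x)^2dx$. Compatibility of the initial condition with the control law means that the initial data satisfy the boundary condition at $x=0$ at time $0$: $T_0'(0)=c\left(\frac1\alpha\int_0^{s_0}(T_0(x)-T_m)\,dx+\frac1\beta(s_0-s_r)\right)$. Exponential stability is understood as usual for a closed-loop system: $D$ and $b$ depend only on the physical parameters, $c$ and $s_r$, not on the particular initial data $(T_0,s_0)$ satisfying the stated conditions. The statement concerns classical solutions of the closed-loop system defined for all $t\ge0$: $s\in C^1([0,\infty))$ with $s(t)>0$; $T$ and $T_x$ are continuous on $\{(x,t):t\ge0,\ 0\le x\le s(t)\}$; $T_t$ and $T_{xx}$ exist and are continuous for $t>0$, $0<x<s(t)$; and all the equations above hold. *)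

theory Defs
  imports "HOL-Analysis.Analysis"
begin

text \<open>
  A temperature \<open>T x t\<close> and an interface \<open>s t\<close> are total functions, but only their values for
  \<open>0 \<le> t\<close> and \<open>0 \<le> x \<le> s t\<close> matter. All spatial first derivatives are therefore taken within
  \<open>{0..l}\<close>, so that they are one-sided at the two ends; for \<open>0 < l\<close> they are unique.
\<close>

definition dx :: "real \<Rightarrow> (real \<Rightarrow> real) \<Rightarrow> real \<Rightarrow> real" where
  "dx l f x = vector_derivative f (at x within {0..l})"

definition H1_norm_sq :: "real \<Rightarrow> real \<Rightarrow> (real \<Rightarrow> real) \<Rightarrow> real" where
  "H1_norm_sq Tm l f =
     integral {0..l} (\<lambda>x. (f x - Tm)\<^sup>2) + integral {0..l} (\<lambda>x. (dx l f x)\<^sup>2)"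

definition control_flux ::
  "real \<Rightarrow> real \<Rightarrow> real \<Rightarrow> real \<Rightarrow> real \<Rightarrow> real \<Rightarrow> real \<Rightarrow> (real \<Rightarrow> real) \<Rightarrow> real" where
  "control_flux c k \<alpha> \<beta> Tm sr l f =
     - c * k * ((1 / \<alpha>) * integral {0..l} (\<lambda>x. f x - Tm) + (1 / \<beta>) * (l - sr))"

definition compatible_init ::
  "real \<Rightarrow> real \<Rightarrow> real \<Rightarrow> real \<Rightarrow> real \<Rightarrow> (real \<Rightarrow> real) \<Rightarrow> real \<Rightarrow> bool" where
  "compatible_init c \<alpha> \<beta> Tm sr T0 s0 \<longleftrightarrow>
     (T0 has_real_derivative
        c * ((1 / \<alpha>) * integral {0..s0} (\<lambda>x. T0 x - Tm) + (1 / \<beta>) * (s0 - sr)))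
       (at 0 within {0..s0})"

definition closed_liquid :: "(real \<Rightarrow> real) \<Rightarrow> (real \<times> real) set" where
  "closed_liquid s = {(x, t). 0 \<le> t \<and> 0 \<le> x \<and> x \<le> s t}"

definition open_liquid :: "(real \<Rightarrow> real) \<Rightarrow> (real \<times> real) set" where
  "open_liquid s = {(x, t). 0 < t \<and> 0 < x \<and> x < s t}"

text \<open>
  The boundary equations are required for \<open>t > 0\<close> only. At \<open>t = 0\<close> the flux condition is the
  compatibility of the initial data, and the other two follow by continuity.
\<close>

definition closed_loop_solution ::
  "real \<Rightarrow> real \<Rightarrow> real \<Rightarrow> real \<Rightarrow> real \<Rightarrow> real \<Rightarrow> (real \<Rightarrow> real) \<Rightarrow> real
    \<Rightarrow> (real \<Rightarrow> real \<Rightarrow> real) \<Rightarrow> (real \<Rightarrow> real) \<Rightarrow> bool" where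
  "closed_loop_solution c k \<alpha> \<beta> Tm sr T0 s0 T s \<longleftrightarrow>
     (\<forall>t\<ge>0. 0 < s t) \<and>
     (\<exists>s'. continuous_on {0..} s' \<and>
        (\<forall>t\<ge>0. (s has_real_derivative s' t) (at t within {0..})) \<and>
        (\<forall>t>0. s' t = - \<beta> * dx (s t) (\<lambda>y. T y t) (s t))) \<and>
     continuous_on (closed_liquid s) (\<lambda>(x, t). T x t) \<and>
     (\<forall>(x, t)\<in>closed_liquid s. (\<lambda>y. T y t) differentiable (at x within {0..s t})) \<and>
     continuous_on (closed_liquid s) (\<lambda>(x, t). dx (s t) (\<lambda>y. T y t) x) \<and>
     (\<exists>Tt Txx.
        continuous_on (open_liquid s) (\<lambda>(x, t). Tt x t) \<and>
        continuous_on (open_liquid s) (\<lambda>(x, t). Txx x t) \<and>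
        (\<forall>(x, t)\<in>open_liquid s.
           ((\<lambda>\<tau>. T x \<tau>) has_real_derivative Tt x t) (at t) \<and>
           ((\<lambda>y. dx (s t) (\<lambda>z. T z t) y) has_real_derivative Txx x t) (at x) \<and>
           Tt x t = \<alpha> * Txx x t)) \<and>
     (\<forall>t>0. - k * dx (s t) (\<lambda>y. T y t) 0 = control_flux c k \<alpha> \<beta> Tm sr (s t) (\<lambda>y. T y t)) \<and>
     (\<forall>t>0. T (s t) t = Tm) \<and>
     (\<forall>x\<in>{0..s0}. T x 0 = T0 x) \<and>
     s 0 = s0"

end

theory Submission
  imports Defs
begin

text \<open>
  Put \<open>u = T - Tm\<close> and \<open>energy t = (1/\<alpha>) \<integral> u + (1/\<beta>) (s - sr)\<close>. The closed loop gives \<open>energy' = - c energy\<close>, so the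
  heat influx \<open>- u\<^sub>x(0, t)\<close> is a positive decaying exponential; the maximum principle then yields \<open>u \<ge> 0\<close>, hence
  \<open>s' \<ge> 0\<close> and \<open>s < sr\<close>. Testing the heat equation with \<open>u\<close> and with \<open>u\<^sub>t\<close> gives
  \<open>(\<parallel>u\<parallel>\<^sup>2/2)' = \<alpha> (influx u(0, t) - \<parallel>u\<^sub>x\<parallel>\<^sup>2)\<close> and \<open>(\<parallel>u\<^sub>x\<parallel>\<^sup>2/2)' \<le> influx u\<^sub>t(0, t)\<close>, where the interface term has been
  dropped because \<open>s' \<ge> 0\<close>. The time derivative in the last term is moved onto the influx, and the sum of both estimates
  with a multiple of \<open>influx\<^sup>2\<close> is an exponentially decaying functional equivalent to the norm.

  The solution is not known to be regular enough to test with \<open>u\<^sub>t\<close>. Instead one tests with a time increment of \<open>u\<close>,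
  which only involves the continuous kernel \<open>K(\<tau>, \<sigma>) = \<integral> u\<^sub>x(\<cdot>, \<tau>) u\<^sub>x(\<cdot>, \<sigma>)\<close>, and lets the increment tend to \<open>0\<close>.
\<close>

subsection \<open>Balance laws on moving intervals\<close>

text \<open>The obstacle is regularity at the edge of the liquid: \<open>u\<close> and
  \<open>p\<close> are continuous up to the boundary, whereas the time derivative and the second
  space derivative are controlled only in the open region and may blow up towards its edge. Hence
  every balance is stated integrated in time and contains only quantities that are continuous up to
  the boundary; even the final Lyapunov inequality is used in integrated form.

  Why time increments suffice: formally, the integral of
  \<open>K \<tau> (t + h) - K \<tau> t\<close> over \<open>\<tau>\<close> in
  \<open>{t..t + h}\<close> is \<open>h\<^sup>2\<close> times the derivative of
  \<open>K t t / 2\<close>, up to higher order. For symmetric \<open>K\<close> it is exactly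
  \<open>h\<^sup>2\<close> times the derivative of an average of \<open>K\<close> over a small
  triangle, so the limit asks for no differentiability of \<open>K\<close>.

  Monotonicity of the interface serves twice. It gives the discarded interface terms their sign, and
  together with \<open>s t < sr\<close> it confines the problem to lengths below \<open>sr\<close>,
  so that all Poincare and trace constants can be expressed by \<open>sr\<close>. This makes the
  decay constants independent of the initial data.\<close>

lemma integral_rescale_unit:
  fixes f :: "real \<Rightarrow> real"
  assumes "0 < l"
  shows "integral {0..l} f = l * integral {0..1} (\<lambda>\<xi>. f (\<xi> * l))"
proof (cases "f integrable_on {0..l}")
  case True
  then have "(f has_integral integral {0..l} f) (cbox 0 l)" by (simp add: integrable_integral)
  from has_integral_affinity'[OF this assms, of 0] assms
  have "((\<lambda>\<xi>. f (\<xi> * l)) has_integral integral {0..l} f / l) {0..1}"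
    by (simp add: mult.commute divide_inverse)
  then show ?thesis using assms by (simp add: integral_unique)
next
  case False
  \<comment> \<open>\<open>integral\<close> defaults to 0 on non-integrable functions, so both sides
    vanish once non-integrability is carried over to the unit interval.\<close>
  have "\<not> (\<lambda>\<xi>. f (\<xi> * l)) integrable_on {0..1}"
  proof
    assume "(\<lambda>\<xi>. f (\<xi> * l)) integrable_on {0..1}"
    then obtain i where i: "((\<lambda>\<xi>. f (\<xi> * l)) has_integral i) (cbox 0 1)" by auto
    have "((\<lambda>x. f ((1/l) *\<^sub>R x * l)) has_integral l * i) (cbox 0 l)"
      using has_integral_affinity'[OF i, of "1/l" 0] assms by (simp add: divide_inverse mult.commute)
    then show False using False assms by (auto simp: integrable_on_def)
  qed
  with False show ?thesis by (simp add: not_integrable_integral)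
qed

text \<open>Total differentiability follows from both partials existing and one of them, here
  \<open>fy\<close>, being continuous; it is then composed with the curve
  \<open>(g t, t)\<close>.\<close>

lemma DERIV_compose_partials:
  fixes f fx fy :: "real \<Rightarrow> real \<Rightarrow> real"
  assumes S: "open S" "(g t, t) \<in> S"
    and fx: "\<And>x y. (x, y) \<in> S \<Longrightarrow> ((\<lambda>x. f x y) has_real_derivative fx x y) (at x)"
    and fy: "\<And>x y. (x, y) \<in> S \<Longrightarrow> ((\<lambda>y. f x y) has_real_derivative fy x y) (at y)"
    and fy_cont: "continuous_on S (\<lambda>(x, y). fy x y)"
    and g: "(g has_real_derivative g') (at t)"
  shows "((\<lambda>t. f (g t) t) has_real_derivative (fx (g t) t * g' + fy (g t) t)) (at t)"
proof -
  \<comment> \<open>The criterion for total differentiability works on a product with convex second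
    factor, hence the ball inside \<open>B\<close>.\<close>
  obtain A B where AB: "open A" "open B" "(g t, t) \<in> A \<times> B" "A \<times> B \<subseteq> S"
    using open_prod_elim[OF S] by blast
  obtain e where e: "e > 0" "ball t e \<subseteq> B" using AB(2,3) open_contains_ball by (metis mem_Sigma_iff)
  have sub: "A \<times> ball t e \<subseteq> S" using AB e by auto
  have opn: "open (A \<times> ball t e)" using AB by (simp add: open_Times)
  have mem: "(g t, t) \<in> A \<times> ball t e" using AB e by auto
  have atw: "at (g t, t) within A \<times> ball t e = at (g t, t)"
    using opn mem by (rule at_within_open[rotated])
  have "((\<lambda>(x, y). f x y) has_derivative
      (\<lambda>(tx, ty). fx (g t) t * tx + blinfun_apply (blinfun_mult_right (fy (g t) t)) ty)) (at (g t, t) within A \<times> ball t e)"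
  proof (rule has_derivative_partialsI[where fx="\<lambda>tx. fx (g t) t * tx" and fy="\<lambda>x y. blinfun_mult_right (fy x y)"])
    show "((\<lambda>x. f x t) has_derivative (\<lambda>tx. fx (g t) t * tx)) (at (g t) within A)"
      using fx[OF S(2)] by (auto simp: has_field_derivative_def intro: has_derivative_at_withinI)
    show "((\<lambda>y. f x y) has_derivative blinfun_apply (blinfun_mult_right (fy x y))) (at y within ball t e)"
      if "x \<in> A" "y \<in> ball t e" for x y
    proof -
      have "(x, y) \<in> S" using that sub by blast
      from fy[OF this] show ?thesis
        unfolding has_field_derivative_def blinfun_mult_right.rep_eq by (rule has_derivative_at_withinI)
    qed
    have "continuous (at (g t, t)) (\<lambda>(x, y). fy x y)"
      using fy_cont S by (simp add: continuous_on_eq_continuous_at)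
    then have "continuous (at (g t, t)) (\<lambda>z. blinfun_mult_right (case z of (x, y) \<Rightarrow> fy x y))"
      by (rule bounded_linear.continuous[OF bounded_linear_blinfun_mult_right])
    then show "continuous (at (g t, t) within A \<times> ball t e) (\<lambda>(x, y). blinfun_mult_right (fy x y))"
      unfolding atw case_prod_unfold by simp
  qed (use mem e in auto)
  then have D: "((\<lambda>(x, y). f x y) has_derivative (\<lambda>(tx, ty). fx (g t) t * tx + fy (g t) t * ty)) (at (g t, t))"
    unfolding atw by simp
  have "((\<lambda>\<tau>. (g \<tau>, \<tau>)) has_derivative (\<lambda>h. (g' * h, h))) (at t)"
    using g by (intro has_derivative_Pair) (auto simp: has_field_derivative_def)
  from has_derivative_compose[OF this D]
  have "((\<lambda>t. f (g t) t) has_derivative (\<lambda>h. fx (g t) t * (g' * h) + fy (g t) t * h)) (at t)"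
    by simp
  then show ?thesis
    unfolding has_field_derivative_def by (rule has_derivative_eq_rhs) (auto simp: fun_eq_iff algebra_simps)
qed

lemma tendsto_integral_shrinking:
  fixes f :: "real \<Rightarrow> real"
  assumes f: "continuous_on {0..1} f" and e: "\<And>n. 0 \<le> e n" "\<And>n. e n \<le> 1/2" "e \<longlonglongrightarrow> 0"
  shows "(\<lambda>n. integral {e n..1 - e n} f) \<longlonglongrightarrow> integral {0..1} f"
proof -
  have int: "f integrable_on {0..1}" using f by (rule integrable_continuous_interval)
  have c: "continuous_on {0..1} (\<lambda>x. integral {0..x} f)" using int by (rule indefinite_integral_continuous_1)
  have eq: "integral {e n..1 - e n} f = integral {0..1 - e n} f - integral {0..e n} f" for n
  proof -
    have "f integrable_on {0..1 - e n}" by (rule integrable_on_subinterval[OF int]) (use e in auto)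
    from Henstock_Kurzweil_Integration.integral_combine[OF _ _ this, of "e n"] show ?thesis using e(1,2)[of n] by simp
  qed
  have 1: "(\<lambda>n. integral {0..1 - e n} f) \<longlonglongrightarrow> integral {0..1} f"
  proof (rule continuous_on_tendsto_compose[OF c, of "\<lambda>n. 1 - e n" 1])
    show "(\<lambda>n. 1 - e n) \<longlonglongrightarrow> 1" using tendsto_diff[OF tendsto_const e(3), of 1] by simp
    show "\<forall>\<^sub>F n in sequentially. 1 - e n \<in> {0..1}"
      by (rule always_eventually) (use e(1,2) in \<open>auto simp: algebra_simps intro: order_trans[OF e(2)]\<close>)
  qed auto
  have 2: "(\<lambda>n. integral {0..e n} f) \<longlonglongrightarrow> integral {0..0} f"
  proof (rule continuous_on_tendsto_compose[OF c e(3)])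
    show "\<forall>\<^sub>F n in sequentially. e n \<in> {0..1}"
      by (rule always_eventually) (use e(1,2) in \<open>auto intro: order_trans[OF e(2)]\<close>)
  qed auto
  show ?thesis using tendsto_diff[OF 1 2] by (simp add: eq)
qed

text \<open>The derivatives of \<open>w\<close> need not extend to the boundary, so the rescaled integral is cut off to
  \<open>x \<in> {e * r t..(1 - e) * r t}\<close> before it is differentiated, and \<open>e\<close> tends to \<open>0\<close> only after integration in time.\<close>

lemma moving_domain_balance:
  fixes w wx wt G R :: "real \<Rightarrow> real \<Rightarrow> real" and r r' :: "real \<Rightarrow> real"
  defines "D a b \<equiv> {(x, t). t \<in> {a..b} \<and> 0 \<le> x \<and> x \<le> r t}"
    and "Q a b \<equiv> {(x, t). t \<in> {a<..<b} \<and> 0 < x \<and> x < r t}"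
  assumes ab: "a \<le> b"
    and r_pos: "\<And>t. t \<in> {a..b} \<Longrightarrow> 0 < r t"
    and r_cont: "continuous_on {a..b} r" and r'_cont: "continuous_on {a..b} r'"
    and r_der: "\<And>t. t \<in> {a<..<b} \<Longrightarrow> (r has_real_derivative r' t) (at t)"
    and w_cont: "continuous_on (D a b) (\<lambda>(x, t). w x t)"
    and G_cont: "continuous_on (D a b) (\<lambda>(x, t). G x t)"
    and R_cont: "continuous_on (D a b) (\<lambda>(x, t). R x t)"
    and wx_cont: "continuous_on (Q a b) (\<lambda>(x, t). wx x t)"
    and wt_cont: "continuous_on (Q a b) (\<lambda>(x, t). wt x t)"
    and w_x: "\<And>x t. (x, t) \<in> Q a b \<Longrightarrow> ((\<lambda>y. w y t) has_real_derivative wx x t) (at x)"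
    and w_t: "\<And>x t. (x, t) \<in> Q a b \<Longrightarrow> ((\<lambda>\<tau>. w x \<tau>) has_real_derivative wt x t) (at t)"
    and G_x: "\<And>x t. (x, t) \<in> Q a b \<Longrightarrow> ((\<lambda>y. G y t) has_real_derivative wt x t + R x t) (at x)"
  shows "((\<lambda>t. r' t * w (r t) t + G (r t) t - G 0 t - integral {0..r t} (\<lambda>x. R x t)) has_integral
      integral {0..r b} (\<lambda>x. w x b) - integral {0..r a} (\<lambda>x. w x a)) {a..b}"
proof -
  \<comment> \<open>The substitution \<open>x = \<xi> * r t\<close> moves everything to a fixed
    rectangle, where compactness and parameter integrals are available.\<close>
  have hat: "continuous_on ({a..b} \<times> {0..1}) (\<lambda>(t, \<xi>). f (\<xi> * r t) t)"
    if f: "continuous_on (D a b) (\<lambda>(x, t). f x t)" for f :: "real \<Rightarrow> real \<Rightarrow> real"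
  proof -
    have "continuous_on ({a..b} \<times> {0..1}) (\<lambda>z. (case (snd z * r (fst z), fst z) of (x, t) \<Rightarrow> f x t))"
    proof (rule continuous_on_compose2[OF f])
      show "continuous_on ({a..b} \<times> {0..1}) (\<lambda>z. (snd z * r (fst z), fst z))"
        by (intro continuous_intros continuous_on_compose2[OF r_cont]) auto
      show "(\<lambda>z. (snd z * r (fst z), fst z)) ` ({a..b} \<times> {0..1}) \<subseteq> D a b"
        by (auto simp: D_def intro!: mult_nonneg_nonneg mult_left_le_one_le less_imp_le[OF r_pos])
    qed
    then show ?thesis by (simp add: case_prod_unfold)
  qed
  have hat_open: "continuous_on ({a<..<b} \<times> {0<..<1}) (\<lambda>(t, \<xi>). f (\<xi> * r t) t)"
    if f: "continuous_on (Q a b) (\<lambda>(x, t). f x t)" for f :: "real \<Rightarrow> real \<Rightarrow> real"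
  proof -
    have "continuous_on ({a<..<b} \<times> {0<..<1}) (\<lambda>z. (case (snd z * r (fst z), fst z) of (x, t) \<Rightarrow> f x t))"
    proof (rule continuous_on_compose2[OF f])
      show "continuous_on ({a<..<b} \<times> {0<..<1}) (\<lambda>z. (snd z * r (fst z), fst z))"
        by (intro continuous_intros continuous_on_compose2[OF r_cont]) auto
      show "(\<lambda>z. (snd z * r (fst z), fst z)) ` ({a<..<b} \<times> {0<..<1}) \<subseteq> Q a b"
      proof (rule image_subsetI)
        fix z assume z: "z \<in> {a<..<b} \<times> {0<..<1::real}"
        then show "(snd z * r (fst z), fst z) \<in> Q a b"
          using r_pos[of "fst z"] by (auto simp: Q_def mult_less_cancel_right2)
      qed
    qed
    then show ?thesis by (simp add: case_prod_unfold)
  qed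
  have Q_open: "open (Q a b)"
  proof -
    have "open ((UNIV \<times> {a<..<b}) \<inter> (\<lambda>z. r (snd z) - fst z) -` {0<..})"
      by (intro continuous_open_preimage continuous_intros continuous_on_compose2[OF r_cont])
        (auto intro: open_Times)
    moreover have "open {z :: real \<times> real. 0 < fst z}" by (intro open_Collect_less continuous_intros)
    moreover have "Q a b = ((UNIV \<times> {a<..<b}) \<inter> (\<lambda>z. r (snd z) - fst z) -` {0<..}) \<inter> {z. 0 < fst z}"
      by (auto simp: Q_def)
    ultimately show ?thesis by auto
  qed
  note hw = hat[OF w_cont] and hG = hat[OF G_cont] and hR = hat[OF R_cont]
  \<comment> \<open>\<open>P e\<close> is the time derivative of \<open>F e\<close>, written without
    \<open>wx\<close> and \<open>wt\<close>. It is therefore bounded uniformly in \<open>e\<close>,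
    which is what dominated convergence needs.\<close>
  define P where "P e t = r' t * ((1 - e) * w ((1 - e) * r t) t - e * w (e * r t) t)
      + G ((1 - e) * r t) t - G (e * r t) t - integral {e..1 - e} (\<lambda>\<xi>. r t * R (\<xi> * r t) t)" for e t
  define F where "F e t = integral {e..1 - e} (\<lambda>\<xi>. r t * w (\<xi> * r t) t)" for e t
  have slice: "continuous_on {0..1} (\<lambda>\<xi>. f (\<xi> * r t) t)"
    if f: "continuous_on (D a b) (\<lambda>(x, t). f x t)" and t: "t \<in> {a..b}" for f :: "real \<Rightarrow> real \<Rightarrow> real" and t
  proof -
    have "continuous_on {0..1} (\<lambda>\<xi>. (case (t, \<xi>) of (t, \<xi>) \<Rightarrow> f (\<xi> * r t) t))"
      by (rule continuous_on_compose2[OF hat[OF f]]) (use t in \<open>auto intro!: continuous_intros\<close>)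
    then show ?thesis by simp
  qed
  have main: "(P e has_integral F e b - F e a) {a..b}" if e: "0 < e" "e < 1/2" for e
  proof (rule fundamental_theorem_of_calculus_interior[OF ab])
    have "continuous_on {a..b} (\<lambda>t. integral (cbox e (1 - e)) (\<lambda>\<xi>. r t * w (\<xi> * r t) t))"
    proof (rule integral_continuous_on_param)
      have "continuous_on ({a..b} \<times> {e..1 - e}) (\<lambda>(t, \<xi>). w (\<xi> * r t) t)"
        by (rule continuous_on_subset[OF hw]) (use e in auto)
      then show "continuous_on ({a..b} \<times> cbox e (1 - e)) (\<lambda>(t, \<xi>). r t * w (\<xi> * r t) t)"
        unfolding case_prod_unfold cbox_interval
        by (intro continuous_intros continuous_on_compose2[OF r_cont]) auto
    qed
    then show "continuous_on {a..b} (F e)" by (simp add: F_def[abs_def])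
    fix t assume t: "t \<in> {a<..<b}"
    define dw where "dw \<tau> \<xi> = r' \<tau> * w (\<xi> * r \<tau>) \<tau> + r \<tau> * (wx (\<xi> * r \<tau>) \<tau> * (\<xi> * r' \<tau>) + wt (\<xi> * r \<tau>) \<tau>)" for \<tau> \<xi>
    have inQ: "(\<xi> * r \<tau>, \<tau>) \<in> Q a b" if "\<tau> \<in> {a<..<b}" "\<xi> \<in> {e..1 - e}" for \<tau> \<xi>
      using that e r_pos[of \<tau>] by (auto simp: Q_def mult_less_cancel_right2)
    have w_der: "((\<lambda>\<tau>. r \<tau> * w (\<xi> * r \<tau>) \<tau>) has_real_derivative dw \<tau> \<xi>) (at \<tau>)"
      if \<tau>: "\<tau> \<in> {a<..<b}" and \<xi>: "\<xi> \<in> {e..1 - e}" for \<tau> \<xi>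
    proof -
      have "((\<lambda>\<tau>. \<xi> * r \<tau>) has_real_derivative \<xi> * r' \<tau>) (at \<tau>)"
        using r_der[OF \<tau>] by (rule DERIV_cmult)
      from DERIV_compose_partials[OF Q_open inQ[OF \<tau> \<xi>] w_x w_t wt_cont this]
      have "((\<lambda>\<tau>. w (\<xi> * r \<tau>) \<tau>) has_real_derivative wx (\<xi> * r \<tau>) \<tau> * (\<xi> * r' \<tau>) + wt (\<xi> * r \<tau>) \<tau>) (at \<tau>)"
        by simp
      from DERIV_mult[OF r_der[OF \<tau>] this] show ?thesis
        unfolding dw_def by (rule DERIV_cong) (simp add: algebra_simps)
    qed
    have int_e: "(\<lambda>\<xi>. f (\<xi> * r \<tau>) \<tau>) integrable_on {e..1 - e}"
      if f: "continuous_on (D a b) (\<lambda>(x, t). f x t)" and \<tau>: "\<tau> \<in> {a..b}" for f :: "real \<Rightarrow> real \<Rightarrow> real" and \<tau>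
      by (rule integrable_continuous_interval, rule continuous_on_subset[OF slice[OF f \<tau>]]) (use e in auto)
    have "((\<lambda>\<tau>. integral (cbox e (1 - e)) (\<lambda>\<xi>. r \<tau> * w (\<xi> * r \<tau>) \<tau>)) has_real_derivative
        integral (cbox e (1 - e)) (dw t)) (at t within {a<..<b})"
    proof (rule leibniz_rule_field_derivative)
      show "((\<lambda>\<tau>. r \<tau> * w (\<xi> * r \<tau>) \<tau>) has_real_derivative dw \<tau> \<xi>) (at \<tau> within {a<..<b})"
        if "\<tau> \<in> {a<..<b}" "\<xi> \<in> cbox e (1 - e)" for \<tau> \<xi>
        using w_der[of \<tau> \<xi>] that by (auto intro: has_field_derivative_at_within)
      show "(\<lambda>\<xi>. r \<tau> * w (\<xi> * r \<tau>) \<tau>) integrable_on cbox e (1 - e)" if "\<tau> \<in> {a<..<b}" for \<tau>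
        using integrable_on_cmult_left[OF int_e[OF w_cont, of \<tau>], of "r \<tau>"] that by auto
      have sub: "{a<..<b} \<times> {e..1 - e} \<subseteq> {a<..<b} \<times> {0<..<1}" using e by auto
      have sub2: "{a<..<b} \<times> {e..1 - e} \<subseteq> {a..b} \<times> {0..1}" using e by auto
      have r1: "continuous_on ({a<..<b} \<times> {e..1 - e}) (\<lambda>z. r (fst z))"
        by (intro continuous_on_compose2[OF r_cont] continuous_intros) auto
      have r2: "continuous_on ({a<..<b} \<times> {e..1 - e}) (\<lambda>z. r' (fst z))"
        by (intro continuous_on_compose2[OF r'_cont] continuous_intros) auto
      show "continuous_on ({a<..<b} \<times> cbox e (1 - e)) (\<lambda>(\<tau>, \<xi>). dw \<tau> \<xi>)"
        unfolding dw_def case_prod_unfold cbox_interval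
        by (intro continuous_intros r1 r2 continuous_on_subset[OF hw[unfolded case_prod_unfold] sub2]
            continuous_on_subset[OF hat_open[OF wx_cont, unfolded case_prod_unfold] sub]
            continuous_on_subset[OF hat_open[OF wt_cont, unfolded case_prod_unfold] sub])
    qed (use t in auto)
    then have der: "(F e has_real_derivative integral {e..1 - e} (dw t)) (at t)"
      using t by (simp add: F_def[abs_def] at_within_open[of t "{a<..<b}"])
    \<comment> \<open>Transport term plus flux: the differential equation makes the time derivative
      \<open>dw t\<close> of the rescaled integrand equal to the \<open>\<xi>\<close>-derivative of
      \<open>N\<close> minus the source \<open>r t * R\<close>. Integration over
      \<open>\<xi>\<close> thus eliminates \<open>wx\<close> and \<open>wt\<close>.\<close>
    define N where "N \<xi> = r' t * \<xi> * w (\<xi> * r t) t + G (\<xi> * r t) t" for \<xi>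
    have t': "t \<in> {a..b}" using t by auto
    have "((\<lambda>\<xi>. dw t \<xi> + r t * R (\<xi> * r t) t) has_integral N (1 - e) - N e) {e..1 - e}"
    proof (rule fundamental_theorem_of_calculus)
      show "(N has_vector_derivative dw t \<xi> + r t * R (\<xi> * r t) t) (at \<xi> within {e..1 - e})"
        if \<xi>: "\<xi> \<in> {e..1 - e}" for \<xi>
      proof -
        have lin: "((\<lambda>\<xi>. \<xi> * r t) has_real_derivative r t) (at \<xi>)"
          by (auto intro!: derivative_eq_intros)
        have c: "((\<lambda>\<xi>. w (\<xi> * r t) t) has_real_derivative wx (\<xi> * r t) t * r t) (at \<xi>)"
          using DERIV_chain2[OF w_x[OF inQ[OF t \<xi>]] lin] .
        have d: "((\<lambda>\<xi>. G (\<xi> * r t) t) has_real_derivative (wt (\<xi> * r t) t + R (\<xi> * r t) t) * r t) (at \<xi>)"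
          using DERIV_chain2[OF G_x[OF inQ[OF t \<xi>]] lin] .
        have "(N has_real_derivative dw t \<xi> + r t * R (\<xi> * r t) t) (at \<xi>)"
          unfolding N_def[abs_def] dw_def
          by (rule derivative_eq_intros c d refl)+ (simp add: algebra_simps)
        then show ?thesis
          by (auto simp: has_real_derivative_iff_has_vector_derivative intro: has_vector_derivative_at_within)
      qed
    qed (use e in auto)
    from has_integral_diff[OF this integrable_integral[OF integrable_on_cmult_left[OF int_e[OF R_cont t'], of "r t"]]]
    have "(dw t has_integral N (1 - e) - N e - integral {e..1 - e} (\<lambda>\<xi>. r t * R (\<xi> * r t) t)) {e..1 - e}"
      by simp
    then have "integral {e..1 - e} (dw t) = P e t"
      by (simp add: integral_unique P_def N_def algebra_simps)
    with der show "(F e has_vector_derivative P e t) (at t)"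
      by (simp add: has_real_derivative_iff_has_vector_derivative)
  qed
  have bdd: "\<exists>M\<ge>0. \<forall>z\<in>S. \<bar>f z\<bar> \<le> M" if "compact S" "continuous_on S f" for f :: "'z::topological_space \<Rightarrow> real" and S
  proof -
    have "bounded (f ` S)" using that by (intro compact_imp_bounded compact_continuous_image)
    then obtain M where "\<And>z. z \<in> S \<Longrightarrow> \<bar>f z\<bar> \<le> M" by (auto simp: bounded_iff)
    then show ?thesis by (intro exI[of _ "max M 0"]) fastforce
  qed
  have comp: "compact ({a..b} \<times> {0..1::real})" by (intro compact_Times compact_Icc)
  obtain Mw where Mw: "Mw \<ge> 0" "\<And>t \<xi>. t \<in> {a..b} \<Longrightarrow> \<xi> \<in> {0..1} \<Longrightarrow> \<bar>w (\<xi> * r t) t\<bar> \<le> Mw"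
    using bdd[OF comp hw] by fastforce
  obtain MG where MG: "MG \<ge> 0" "\<And>t \<xi>. t \<in> {a..b} \<Longrightarrow> \<xi> \<in> {0..1} \<Longrightarrow> \<bar>G (\<xi> * r t) t\<bar> \<le> MG"
    using bdd[OF comp hG] by fastforce
  obtain MR where MR: "MR \<ge> 0" "\<And>t \<xi>. t \<in> {a..b} \<Longrightarrow> \<xi> \<in> {0..1} \<Longrightarrow> \<bar>R (\<xi> * r t) t\<bar> \<le> MR"
    using bdd[OF comp hR] by fastforce
  obtain Mr where Mr: "Mr \<ge> 0" "\<And>t. t \<in> {a..b} \<Longrightarrow> \<bar>r t\<bar> \<le> Mr"
    using bdd[OF compact_Icc r_cont] by fastforce
  obtain Mr' where Mr': "Mr' \<ge> 0" "\<And>t. t \<in> {a..b} \<Longrightarrow> \<bar>r' t\<bar> \<le> Mr'"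
    using bdd[OF compact_Icc r'_cont] by fastforce
  \<comment> \<open>The shift by 3 keeps \<open>e n\<close> below 1/2, so that the cut-off interval
    is nondegenerate from the start.\<close>
  define e where "e n = inverse (real (n + 3))" for n
  have e_pos: "0 < e n" and e_le: "e n < 1/2" for n
    by (auto simp: e_def field_simps)
  have e_lim: "e \<longlonglongrightarrow> 0" unfolding e_def
    using LIMSEQ_ignore_initial_segment[OF lim_inverse_n', of 3] by (simp add: inverse_eq_divide)
  have e_lim1: "(\<lambda>n. 1 - e n) \<longlonglongrightarrow> 1" using tendsto_diff[OF tendsto_const e_lim, of 1] by simp
  have F_lim: "(\<lambda>n. F (e n) t) \<longlonglongrightarrow> integral {0..r t} (\<lambda>x. w x t)" if t: "t \<in> {a..b}" for t
  proof -
    have "integral {0..r t} (\<lambda>x. w x t) = integral {0..1} (\<lambda>\<xi>. r t * w (\<xi> * r t) t)"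
      by (simp add: integral_rescale_unit[OF r_pos[OF t]])
    moreover have "(\<lambda>n. F (e n) t) \<longlonglongrightarrow> integral {0..1} (\<lambda>\<xi>. r t * w (\<xi> * r t) t)"
      unfolding F_def
      by (rule tendsto_integral_shrinking)
        (use e_pos e_le e_lim in \<open>auto intro!: continuous_intros slice[OF w_cont t] less_imp_le\<close>)
    ultimately show ?thesis by simp
  qed
  show ?thesis
  proof (rule has_integral_dominated_convergence[where f="\<lambda>n. P (e n)" and
        h="\<lambda>_. Mr' * (Mw + Mw) + MG + MG + Mr * MR" and y="\<lambda>n. F (e n) b - F (e n) a"])
    show "\<And>n. (P (e n) has_integral F (e n) b - F (e n) a) {a..b}" using main e_pos e_le by blast
    show "(\<lambda>_. Mr' * (Mw + Mw) + MG + MG + Mr * MR) integrable_on {a..b}" by (rule integrable_const_ivl)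
    show "(\<lambda>n. F (e n) b - F (e n) a) \<longlonglongrightarrow> integral {0..r b} (\<lambda>x. w x b) - integral {0..r a} (\<lambda>x. w x a)"
      by (intro tendsto_diff F_lim) (use ab in auto)
    show "\<forall>t\<in>{a..b}. (\<lambda>n. P (e n) t) \<longlonglongrightarrow> r' t * w (r t) t + G (r t) t - G 0 t - integral {0..r t} (\<lambda>x. R x t)"
    proof
      fix t assume t: "t \<in> {a..b}"
      have lim: "(\<lambda>n. f (d n * r t) t) \<longlonglongrightarrow> f (l * r t) t"
        if f: "continuous_on (D a b) (\<lambda>(x, t). f x t)" and d: "d \<longlonglongrightarrow> l" "\<And>n. d n \<in> {0..1}" "l \<in> {0..1}"
        for f :: "real \<Rightarrow> real \<Rightarrow> real" and d l
        by (rule continuous_on_tendsto_compose[OF slice[OF f t] d(1)]) (use d in auto)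
      have e01: "e n \<in> {0..1}" "1 - e n \<in> {0..1}" for n
        using e_pos[of n] e_le[of n] by auto
      have "(\<lambda>n. integral {e n..1 - e n} (\<lambda>\<xi>. r t * R (\<xi> * r t) t)) \<longlonglongrightarrow> integral {0..1} (\<lambda>\<xi>. r t * R (\<xi> * r t) t)"
        by (rule tendsto_integral_shrinking)
          (use e_pos e_le e_lim in \<open>auto intro!: continuous_intros slice[OF R_cont t] less_imp_le\<close>)
      moreover have "integral {0..1} (\<lambda>\<xi>. r t * R (\<xi> * r t) t) = integral {0..r t} (\<lambda>x. R x t)"
        by (simp add: integral_rescale_unit[OF r_pos[OF t]])
      ultimately have "(\<lambda>n. P (e n) t) \<longlonglongrightarrow> r' t * (1 * w (1 * r t) t - 0 * w (0 * r t) t)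
         + G (1 * r t) t - G (0 * r t) t - integral {0..r t} (\<lambda>x. R x t)"
        unfolding P_def by (intro tendsto_intros lim w_cont G_cont e_lim e_lim1 e01) auto
      then show "(\<lambda>n. P (e n) t) \<longlonglongrightarrow> r' t * w (r t) t + G (r t) t - G 0 t - integral {0..r t} (\<lambda>x. R x t)"
        by simp
    qed
    show "\<forall>t\<in>{a..b}. norm (P (e n) t) \<le> Mr' * (Mw + Mw) + MG + MG + Mr * MR" for n
    proof
      fix t assume t: "t \<in> {a..b}"
      have e: "0 < e n" "e n < 1/2" using e_pos e_le by auto
      have "norm (integral {e n..1 - e n} (\<lambda>\<xi>. r t * R (\<xi> * r t) t)) \<le> (Mr * MR) * (1 - e n - e n)"
      proof (rule integral_bound)
        show "continuous_on {e n..1 - e n} (\<lambda>\<xi>. r t * R (\<xi> * r t) t)"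
          by (rule continuous_on_subset[of "{0..1}"]) (use e in \<open>auto intro!: continuous_intros slice[OF R_cont t]\<close>)
        show "norm (r t * R (\<xi> * r t) t) \<le> Mr * MR" if "\<xi> \<in> {e n..1 - e n}" for \<xi>
          using Mr(2)[OF t] MR(2)[OF t, of \<xi>] Mr(1) e that by (auto simp: abs_mult intro!: mult_mono)
      qed (use e in auto)
      also have "\<dots> \<le> Mr * MR" using e Mr MR by (simp add: mult_left_le)
      finally have 1: "\<bar>integral {e n..1 - e n} (\<lambda>\<xi>. r t * R (\<xi> * r t) t)\<bar> \<le> Mr * MR" by simp
      have *: "\<bar>d * w (d * r t) t\<bar> \<le> Mw" if "d \<in> {0..1}" for d
        using mult_mono[of "\<bar>d\<bar>" 1 "\<bar>w (d * r t) t\<bar>" Mw] Mw(2)[OF t that] that by (simp add: abs_mult)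
      have "\<bar>(1 - e n) * w ((1 - e n) * r t) t\<bar> \<le> Mw" "\<bar>e n * w (e n * r t) t\<bar> \<le> Mw"
        using *[of "1 - e n"] *[of "e n"] e by auto
      then have "\<bar>(1 - e n) * w ((1 - e n) * r t) t - e n * w (e n * r t) t\<bar> \<le> Mw + Mw" by linarith
      then have "\<bar>r' t * ((1 - e n) * w ((1 - e n) * r t) t - e n * w (e n * r t) t)\<bar> \<le> Mr' * (Mw + Mw)"
        unfolding abs_mult using Mr'(2)[OF t] Mr'(1) Mw(1) by (intro mult_mono) auto
      with 1 MG(2)[OF t, of "1 - e n"] MG(2)[OF t, of "e n"] e
      show "norm (P (e n) t) \<le> Mr' * (Mw + Mw) + MG + MG + Mr * MR"
        unfolding P_def real_norm_def by auto
    qed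
  qed
qed

subsection \<open>Energy inequality for kernels\<close>

lemma integral_rescale_Icc:
  fixes f :: "real \<Rightarrow> real"
  assumes "a \<le> b" "continuous_on {a..b} f"
  shows "integral {a..b} f = (b - a) * integral {0..1} (\<lambda>\<xi>. f (a + \<xi> * (b - a)))"
proof (cases "a = b")
  case False
  then have ab: "0 < b - a" using assms by simp
  have "(f has_integral integral {a..b} f) (cbox a b)"
    using assms by (simp add: integrable_integral integrable_continuous_interval)
  from has_integral_affinity'[OF this ab, of a] ab
  have "((\<lambda>\<xi>. f ((b - a) * \<xi> + a)) has_integral integral {a..b} f / (b - a)) {0..1}"
    by (simp add: divide_inverse mult.commute[of "inverse _"])
  then show ?thesis using ab by (simp add: integral_unique add.commute mult.commute)
qed simp

lemma integral_reflect_shift: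
  fixes f :: "real \<Rightarrow> real"
  shows "integral {0..h} (\<lambda>\<eta>. f (t + h - \<eta>)) = integral {t..t + h} f"
proof -
  have "integral {0..h} (\<lambda>\<eta>. f (t + h - \<eta>)) = integral {-h..0} (\<lambda>x. f (t + h + x))"
    using Henstock_Kurzweil_Integration.integral_reflect_real[of 0 "-h" "\<lambda>x. f (t + h + x)"] by simp
  also have "\<dots> = integral {t..t + h} f"
    using integral_shift_Icc_real[of "-h" 0 f "t + h"] by (simp add: o_def add.commute)
  finally show ?thesis .
qed

lemma integral_shift_real:
  fixes f :: "real \<Rightarrow> real"
  shows "integral {0..h} (\<lambda>\<eta>. f (t + \<eta>)) = integral {t..t + h} f"
  using integral_shift_Icc_real[of 0 h f t] by (simp add: o_def add.commute)

text \<open>A single \<open>F\<close> valid for all end points reduces differentiation of integrals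
  with moving limits to the chain rule.\<close>

lemma antiderivative_UNIV:
  fixes f :: "real \<Rightarrow> real"
  assumes "continuous_on UNIV f"
  shows "\<exists>F. (\<forall>x. (F has_real_derivative f x) (at x)) \<and> (\<forall>a b. a \<le> b \<longrightarrow> integral {a..b} f = F b - F a)"
proof -
  have "\<exists>F. \<forall>x::real. -\<infinity> < ereal x \<longrightarrow> ereal x < \<infinity> \<longrightarrow> (F has_vector_derivative f x) (at x)"
    by (rule einterval_antiderivative) (use assms in \<open>auto simp: continuous_on_eq_continuous_at\<close>)
  then obtain F where F: "\<And>x. (F has_vector_derivative f x) (at x)" by auto
  have "integral {a..b} f = F b - F a" if "a \<le> b" for a b
    by (rule integral_unique, rule fundamental_theorem_of_calculus[OF that])
      (rule has_vector_derivative_at_within[OF F])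
  with F show ?thesis unfolding has_real_derivative_iff_has_vector_derivative by blast
qed

text \<open>The forward Steklov average, which turns a merely continuous function into a
  differentiable one.\<close>

definition forward_mean :: "(real \<Rightarrow> real) \<Rightarrow> real \<Rightarrow> real \<Rightarrow> real" where
  "forward_mean f h t = integral {t..t + h} f / h"

lemma forward_mean_DERIV:
  assumes "continuous_on UNIV f" "0 < h"
  shows "(forward_mean f h has_real_derivative (f (t + h) - f t) / h) (at t)"
proof -
  obtain F where F: "\<And>x. (F has_real_derivative f x) (at x)"
    "\<And>a b. a \<le> b \<Longrightarrow> integral {a..b} f = F b - F a" using antiderivative_UNIV[OF assms(1)] by blast
  have "((\<lambda>t. (F (t + h) - F t) / h) has_real_derivative (f (t + h) - f t) / h) (at t)"
    using assms(2) by (auto intro!: derivative_eq_intros DERIV_chain2[OF F(1)] F(1))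
  then show ?thesis using assms(2) by (simp add: forward_mean_def[abs_def] F(2))
qed

lemma forward_mean_tendsto:
  assumes f: "continuous_on UNIV f" and h: "\<And>n. 0 < h n" "h \<longlonglongrightarrow> 0"
  shows "(\<lambda>n. forward_mean f (h n) t) \<longlonglongrightarrow> f t"
proof -
  obtain F where F: "\<And>x. (F has_real_derivative f x) (at x)"
    "\<And>a b. a \<le> b \<Longrightarrow> integral {a..b} f = F b - F a" using antiderivative_UNIV[OF f] by blast
  have "((\<lambda>h. (F (t + h) - F t) / h) \<longlongrightarrow> f t) (at 0)" using F(1)[of t] by (simp add: DERIV_def)
  moreover have "filterlim h (at 0) sequentially"
    using h by (auto simp: filterlim_at less_imp_neq[symmetric] intro!: always_eventually)
  ultimately have "(\<lambda>n. (F (t + h n) - F t) / h n) \<longlonglongrightarrow> f t"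
    by (rule filterlim_compose)
  then show ?thesis using h by (simp add: forward_mean_def F(2) less_imp_le)
qed

lemma forward_mean_bound:
  assumes f: "continuous_on UNIV f" and "0 < h" "\<And>x. x \<in> {t..t + h} \<Longrightarrow> \<bar>f x\<bar> \<le> M"
  shows "\<bar>forward_mean f h t\<bar> \<le> M"
proof -
  have "norm (integral {t..t + h} f) \<le> M * (t + h - t)"
    by (rule integral_bound) (use assms in \<open>auto intro: continuous_on_subset\<close>)
  then show ?thesis using assms(2) by (simp add: forward_mean_def field_simps)
qed

text \<open>A triangle rather than the square \<open>{t..t + h} \<times> {t..t + h}\<close>: parametrised by the lag \<open>\<eta>\<close>, it can be
  differentiated under the integral sign although \<open>K\<close> is merely continuous.\<close>

definition lag_mean :: "(real \<Rightarrow> real \<Rightarrow> real) \<Rightarrow> real \<Rightarrow> real \<Rightarrow> real" where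
  "lag_mean K h t = integral {0..h} (\<lambda>\<eta>. integral {t + \<eta>..t + h} (\<lambda>\<sigma>. K \<sigma> (\<sigma> - \<eta>))) / h\<^sup>2"

lemma continuous_on_kernel:
  fixes K :: "real \<Rightarrow> real \<Rightarrow> real"
  assumes "continuous_on UNIV (\<lambda>(x, y). K x y)" "continuous_on S f" "continuous_on S g"
  shows "continuous_on S (\<lambda>z. K (f z) (g z))"
  using continuous_on_compose2[OF assms(1) continuous_on_Pair[OF assms(2,3)]] by simp

text \<open>On the fixed domain \<open>{0..1}\<close>, continuity in \<open>\<eta>\<close> and the
  limit of small \<open>h\<close> become continuity of parameter integrals.\<close>

lemma lag_integral_rescale:
  fixes K :: "real \<Rightarrow> real \<Rightarrow> real"
  assumes K: "continuous_on UNIV (\<lambda>(x, y). K x y)" and "\<eta> \<le> h"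
  shows "integral {t + \<eta>..t + h} (\<lambda>\<sigma>. K \<sigma> (\<sigma> - \<eta>)) =
    (h - \<eta>) * integral {0..1} (\<lambda>\<xi>. K (t + \<eta> + \<xi> * (h - \<eta>)) (t + \<xi> * (h - \<eta>)))"
proof -
  have "continuous_on {t + \<eta>..t + h} (\<lambda>\<sigma>. K \<sigma> (\<sigma> - \<eta>))"
    by (intro continuous_on_kernel[OF K] continuous_intros)
  from integral_rescale_Icc[OF _ this] assms(2)
  have "integral {t + \<eta>..t + h} (\<lambda>\<sigma>. K \<sigma> (\<sigma> - \<eta>)) = (t + h - (t + \<eta>)) *
    integral {0..1} (\<lambda>\<xi>. K (t + \<eta> + \<xi> * (t + h - (t + \<eta>))) (t + \<eta> + \<xi> * (t + h - (t + \<eta>)) - \<eta>))" by simp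
  moreover have "t + h - (t + \<eta>) = h - \<eta>" "\<And>x. t + \<eta> + x - \<eta> = t + x" by simp_all
  ultimately show ?thesis by simp
qed

lemma lag_integral_continuous:
  fixes K :: "real \<Rightarrow> real \<Rightarrow> real"
  assumes K: "continuous_on UNIV (\<lambda>(x, y). K x y)"
  shows "continuous_on {0..h} (\<lambda>\<eta>. integral {t + \<eta>..t + h} (\<lambda>\<sigma>. K \<sigma> (\<sigma> - \<eta>)))"
proof -
  have "continuous_on {0..h} (\<lambda>\<eta>. integral (cbox 0 1) (\<lambda>\<xi>. K (t + \<eta> + \<xi> * (h - \<eta>)) (t + \<xi> * (h - \<eta>))))"
    by (rule integral_continuous_on_param)
      (auto simp: case_prod_unfold intro!: continuous_on_kernel[OF K] continuous_intros)
  then have "continuous_on {0..h} (\<lambda>\<eta>. (h - \<eta>) * integral {0..1} (\<lambda>\<xi>. K (t + \<eta> + \<xi> * (h - \<eta>)) (t + \<xi> * (h - \<eta>))))"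
    by (auto intro!: continuous_intros)
  then show ?thesis
    by (rule continuous_on_eq) (simp add: lag_integral_rescale[OF K])
qed

text \<open>For a fixed lag only the two end points of the inner integral move. Collected over all
  lags they are two edges of the triangle, which the symmetry of \<open>K\<close> turns into
  integrals over \<open>{t..t + h}\<close>: precisely the expression produced by testing with an
  increment.\<close>

lemma lag_mean_DERIV:
  fixes K :: "real \<Rightarrow> real \<Rightarrow> real"
  assumes K: "continuous_on UNIV (\<lambda>(x, y). K x y)" and sym: "\<And>x y. K x y = K y x" and h: "0 < h"
  shows "(lag_mean K h has_real_derivative integral {t..t + h} (\<lambda>\<tau>. K \<tau> (t + h) - K \<tau> t) / h\<^sup>2) (at t)"
proof -
  have "((\<lambda>t. integral (cbox 0 h) (\<lambda>\<eta>. integral {t + \<eta>..t + h} (\<lambda>\<sigma>. K \<sigma> (\<sigma> - \<eta>)))) has_real_derivative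
      integral (cbox 0 h) (\<lambda>\<eta>. K (t + h) (t + h - \<eta>) - K (t + \<eta>) t)) (at t within UNIV)"
  proof (rule leibniz_rule_field_derivative)
    show "((\<lambda>t. integral {t + \<eta>..t + h} (\<lambda>\<sigma>. K \<sigma> (\<sigma> - \<eta>))) has_real_derivative K (t + h) (t + h - \<eta>) - K (t + \<eta>) t) (at t within UNIV)"
      if \<eta>: "\<eta> \<in> cbox 0 h" for t \<eta>
    proof -
      have "continuous_on UNIV (\<lambda>\<sigma>. K \<sigma> (\<sigma> - \<eta>))" by (intro continuous_on_kernel[OF K] continuous_intros)
      then obtain F where F: "\<And>x. (F has_real_derivative K x (x - \<eta>)) (at x)"
        "\<And>a b. a \<le> b \<Longrightarrow> integral {a..b} (\<lambda>\<sigma>. K \<sigma> (\<sigma> - \<eta>)) = F b - F a"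
        using antiderivative_UNIV by blast
      have "((\<lambda>t. F (t + h) - F (t + \<eta>)) has_real_derivative K (t + h) (t + h - \<eta>) - K (t + \<eta>) t) (at t)"
        by (auto intro!: derivative_eq_intros DERIV_chain2[OF F(1)])
      then show ?thesis using \<eta> by (simp add: F(2))
    qed
    show "(\<lambda>\<eta>. integral {t + \<eta>..t + h} (\<lambda>\<sigma>. K \<sigma> (\<sigma> - \<eta>))) integrable_on cbox 0 h" for t
      using lag_integral_continuous[OF K] by (auto intro: integrable_continuous_interval)
    show "continuous_on (UNIV \<times> cbox 0 h) (\<lambda>(t, \<eta>). K (t + h) (t + h - \<eta>) - K (t + \<eta>) t)"
      by (auto simp: case_prod_unfold intro!: continuous_on_kernel[OF K] continuous_intros)
  qed auto
  moreover have "integral (cbox 0 h) (\<lambda>\<eta>. K (t + h) (t + h - \<eta>) - K (t + \<eta>) t)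
      = integral {t..t + h} (\<lambda>\<tau>. K \<tau> (t + h) - K \<tau> t)"
  proof -
    have "integral {0..h} (\<lambda>\<eta>. K (t + h) (t + h - \<eta>) - K (t + \<eta>) t)
      = integral {0..h} (\<lambda>\<eta>. K (t + h - \<eta>) (t + h)) - integral {0..h} (\<lambda>\<eta>. K (t + \<eta>) t)"
      unfolding sym[of "t + h" "t + h - _"]
      by (intro Henstock_Kurzweil_Integration.integral_diff integrable_continuous_interval continuous_on_kernel[OF K] continuous_intros)
    also have "\<dots> = integral {t..t + h} (\<lambda>\<tau>. K \<tau> (t + h)) - integral {t..t + h} (\<lambda>\<tau>. K \<tau> t)"
      using integral_reflect_shift[of h "\<lambda>\<tau>. K \<tau> (t + h)" t] integral_shift_real[of h "\<lambda>\<tau>. K \<tau> t" t] by simp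
    also have "\<dots> = integral {t..t + h} (\<lambda>\<tau>. K \<tau> (t + h) - K \<tau> t)"
      by (intro Henstock_Kurzweil_Integration.integral_diff[symmetric] integrable_continuous_interval continuous_on_kernel[OF K] continuous_intros)
    finally show ?thesis by simp
  qed
  ultimately show ?thesis
    unfolding lag_mean_def[abs_def] by (auto intro: DERIV_cdivide)
qed

text \<open>The triangle has area \<open>h\<^sup>2 / 2\<close>, whence half the diagonal value.
  Scaling both variables by \<open>h\<close> gives a function \<open>M\<close> that is continuous at
  \<open>h = 0\<close> as well, so the limit is an evaluation.\<close>

lemma lag_mean_tendsto:
  fixes K :: "real \<Rightarrow> real \<Rightarrow> real"
  assumes K: "continuous_on UNIV (\<lambda>(x, y). K x y)" and h: "\<And>n. 0 < h n" "h \<longlonglongrightarrow> 0"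
  shows "(\<lambda>n. lag_mean K (h n) t) \<longlonglongrightarrow> K t t / 2"
proof -
  define M where "M h = integral {0..1} (\<lambda>\<zeta>. (1 - \<zeta>) *
    integral {0..1} (\<lambda>\<xi>. K (t + \<zeta> * h + \<xi> * (h - \<zeta> * h)) (t + \<xi> * (h - \<zeta> * h))))" for h
  have eq: "lag_mean K h t = M h" if h: "0 < h" for h
  proof -
    have "lag_mean K h t = (1 / h) * integral {0..1} (\<lambda>\<zeta>. integral {t + \<zeta> * h..t + h} (\<lambda>\<sigma>. K \<sigma> (\<sigma> - \<zeta> * h)))"
      using integral_rescale_Icc[OF _ lag_integral_continuous[OF K], of h t] h
      by (simp add: lag_mean_def power2_eq_square)
    also have "integral {0..1} (\<lambda>\<zeta>. integral {t + \<zeta> * h..t + h} (\<lambda>\<sigma>. K \<sigma> (\<sigma> - \<zeta> * h))) =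
       integral {0..1} (\<lambda>\<zeta>. h * ((1 - \<zeta>) * integral {0..1} (\<lambda>\<xi>. K (t + \<zeta> * h + \<xi> * (h - \<zeta> * h)) (t + \<xi> * (h - \<zeta> * h)))))"
    proof (rule integral_cong)
      fix \<zeta> :: real assume "\<zeta> \<in> {0..1}"
      then have "\<zeta> * h \<le> h" using h by simp
      from lag_integral_rescale[OF K this, of t]
      show "integral {t + \<zeta> * h..t + h} (\<lambda>\<sigma>. K \<sigma> (\<sigma> - \<zeta> * h)) =
        h * ((1 - \<zeta>) * integral {0..1} (\<lambda>\<xi>. K (t + \<zeta> * h + \<xi> * (h - \<zeta> * h)) (t + \<xi> * (h - \<zeta> * h))))"
        by (simp add: algebra_simps)
    qed
    finally show ?thesis using h by (simp add: M_def)
  qed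
  have "continuous_on UNIV (\<lambda>z. integral (cbox 0 1) (\<lambda>\<xi>. K (t + snd z * fst z + \<xi> * (fst z - snd z * fst z)) (t + \<xi> * (fst z - snd z * fst z))))"
    by (rule integral_continuous_on_param)
      (auto simp: case_prod_unfold intro!: continuous_on_kernel[OF K] continuous_intros)
  then have "continuous_on UNIV (\<lambda>h. integral (cbox 0 1) (\<lambda>\<zeta>. (1 - \<zeta>) *
    integral {0..1} (\<lambda>\<xi>. K (t + \<zeta> * h + \<xi> * (h - \<zeta> * h)) (t + \<xi> * (h - \<zeta> * h)))))"
    by (intro integral_continuous_on_param)
      (auto simp: case_prod_unfold intro!: continuous_intros elim: continuous_on_subset)
  then have "continuous_on UNIV M" by (simp add: M_def[abs_def])
  then have "(\<lambda>n. M (h n)) \<longlonglongrightarrow> M 0" by (rule continuous_on_tendsto_compose[OF _ h(2)]) auto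
  moreover have "M 0 = K t t / 2"
  proof -
    have "((\<lambda>\<zeta>. 1 - \<zeta>) has_integral (1 - 1\<^sup>2 / 2) - (0 - 0\<^sup>2 / 2)) {0..1::real}"
      by (rule fundamental_theorem_of_calculus)
        (auto simp: has_real_derivative_iff_has_vector_derivative[symmetric] intro!: derivative_eq_intros)
    then have "integral {0..1} (\<lambda>\<zeta>. 1 - \<zeta> :: real) = 1/2" by (simp add: integral_unique)
    then show ?thesis by (simp add: M_def)
  qed
  ultimately show ?thesis using h by (simp add: eq)
qed

text \<open>Formally, \<open>le\<close> says that the derivative of \<open>K t t / 2\<close> is at
  most \<open>q t\<close> times the derivative of \<open>v\<close>, and the conclusion is its
  integral after the time derivative has been moved from \<open>v\<close> to \<open>q\<close>. The
  regularisation \<open>W n\<close> of \<open>K t t / 2 - q t * v t\<close> is differentiable; in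
  its derivative, \<open>le\<close> cancels the term with the increment of \<open>v\<close>, and
  only averages of \<open>q'\<close> and \<open>v\<close> remain.\<close>

theorem kernel_energy_le:
  fixes K :: "real \<Rightarrow> real \<Rightarrow> real"
  assumes K: "continuous_on UNIV (\<lambda>(x, y). K x y)" and sym: "\<And>x y. K x y = K y x"
    and v: "continuous_on UNIV v"
    and q: "\<And>x. (q has_real_derivative q' x) (at x)" and q': "continuous_on UNIV q'"
    and le: "\<And>t h. a \<le> t \<Longrightarrow> 0 < h \<Longrightarrow>
      integral {t..t + h} (\<lambda>\<tau>. K \<tau> (t + h) - K \<tau> t) \<le> integral {t..t + h} q * (v (t + h) - v t)"
    and ab: "a \<le> b"
  shows "(K b b / 2 - q b * v b) - (K a a / 2 - q a * v a) \<le> - integral {a..b} (\<lambda>t. q' t * v t)"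
proof -
  have q_cont: "continuous_on UNIV q" by (rule DERIV_continuous_on[OF has_field_derivative_at_within[OF q]])
  define h where "h n = 1 / real (Suc n)" for n
  have h: "\<And>n. 0 < h n" "h \<longlonglongrightarrow> 0" "\<And>n. h n \<le> 1"
    unfolding h_def using LIMSEQ_Suc[OF lim_inverse_n'] by auto
  define W where "W n t = lag_mean K (h n) t - forward_mean q (h n) t * forward_mean v (h n) t" for n t
  define V where "V n t = forward_mean q' (h n) t * forward_mean v (h n) t" for n t
  have fm_cont: "continuous_on S (forward_mean f (h n))" if "continuous_on UNIV f" for f n S
    by (rule DERIV_continuous_on[OF has_field_derivative_at_within[OF forward_mean_DERIV[OF that h(1)]]])
  have V_int: "V n integrable_on {a..b}" for n
    unfolding V_def by (intro integrable_continuous_interval continuous_on_mult fm_cont v q')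
  have W_le: "W n b - W n a \<le> - integral {a..b} (V n)" for n
  proof -
    define W' where "W' t = integral {t..t + h n} (\<lambda>\<tau>. K \<tau> (t + h n) - K \<tau> t) / (h n)\<^sup>2
      - ((q (t + h n) - q t) / h n * forward_mean v (h n) t + (v (t + h n) - v t) / h n * forward_mean q (h n) t)" for t
    have "(W' has_integral W n b - W n a) {a..b}"
    proof (rule fundamental_theorem_of_calculus[OF ab])
      fix t
      have L: "(lag_mean K (h n) has_real_derivative integral {t..t + h n} (\<lambda>\<tau>. K \<tau> (t + h n) - K \<tau> t) / (h n)\<^sup>2) (at t)"
        using K sym h(1) by (rule lag_mean_DERIV)
      have "((\<lambda>t. forward_mean q (h n) t * forward_mean v (h n) t) has_real_derivative
         (q (t + h n) - q t) / h n * forward_mean v (h n) t + (v (t + h n) - v t) / h n * forward_mean q (h n) t) (at t)"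
        by (rule DERIV_mult; rule forward_mean_DERIV) (use q_cont v h(1) in auto)
      then have "(W n has_real_derivative W' t) (at t)"
        unfolding W_def[abs_def] W'_def by (rule DERIV_diff[OF L])
      then show "(W n has_vector_derivative W' t) (at t within {a..b})"
        unfolding has_real_derivative_iff_has_vector_derivative by (rule has_vector_derivative_at_within)
    qed
    moreover have "((\<lambda>t. - V n t) has_integral - integral {a..b} (V n)) {a..b}"
      using has_integral_neg[OF integrable_integral[OF V_int]] .
    moreover have "W' t \<le> - V n t" if t: "t \<in> {a..b}" for t
    proof -
      have "(q' has_integral q (t + h n) - q t) {t..t + h n}"
        using h(1)[of n] q by (intro fundamental_theorem_of_calculus)
          (auto simp: has_real_derivative_iff_has_vector_derivative[symmetric] intro: has_field_derivative_at_within)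
      then have "(q (t + h n) - q t) / h n = forward_mean q' (h n) t"
        by (simp add: forward_mean_def integral_unique)
      moreover have "integral {t..t + h n} (\<lambda>\<tau>. K \<tau> (t + h n) - K \<tau> t) / (h n)\<^sup>2
          \<le> integral {t..t + h n} q * (v (t + h n) - v t) / (h n)\<^sup>2"
        using le[of t "h n"] t h(1)[of n] by (intro divide_right_mono) auto
      then have "integral {t..t + h n} (\<lambda>\<tau>. K \<tau> (t + h n) - K \<tau> t) / (h n)\<^sup>2
          \<le> (v (t + h n) - v t) / h n * forward_mean q (h n) t"
        by (simp add: forward_mean_def power2_eq_square mult.commute)
      ultimately show ?thesis unfolding W'_def V_def by simp
    qed
    ultimately show ?thesis by (rule has_integral_le)
  qed
  \<comment> \<open>Averaging windows that start in \<open>{a..b}\<close> have length at most 1, so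
    bounds on \<open>{a..b + 1}\<close> dominate all averages.\<close>
  have bdd: "\<exists>M\<ge>0. \<forall>x\<in>{a..b + 1}. \<bar>f x\<bar> \<le> M" if f: "continuous_on UNIV f" for f :: "real \<Rightarrow> real"
  proof -
    have "bounded (f ` {a..b + 1})"
      by (intro compact_imp_bounded compact_continuous_image compact_Icc continuous_on_subset[OF f]) auto
    then obtain M where "\<forall>x\<in>{a..b + 1}. \<bar>f x\<bar> \<le> M" by (auto simp: bounded_iff)
    then show ?thesis by (intro exI[of _ "max M 0"]) fastforce
  qed
  obtain Mq where Mq: "Mq \<ge> 0" "\<And>x. x \<in> {a..b + 1} \<Longrightarrow> \<bar>q' x\<bar> \<le> Mq" using bdd[OF q'] by blast
  obtain Mv where Mv: "Mv \<ge> 0" "\<And>x. x \<in> {a..b + 1} \<Longrightarrow> \<bar>v x\<bar> \<le> Mv" using bdd[OF v] by blast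
  have "(\<lambda>n. W n t) \<longlonglongrightarrow> K t t / 2 - q t * v t" for t
    unfolding W_def by (intro tendsto_intros lag_mean_tendsto forward_mean_tendsto K v q_cont h)
  then have "(\<lambda>n. W n b - W n a) \<longlonglongrightarrow> (K b b / 2 - q b * v b) - (K a a / 2 - q a * v a)"
    by (intro tendsto_diff)
  moreover have "(\<lambda>n. - integral {a..b} (V n)) \<longlonglongrightarrow> - integral {a..b} (\<lambda>t. q' t * v t)"
  proof (rule tendsto_minus, rule dominated_convergence(2)[OF V_int, where h="\<lambda>_. Mq * Mv"])
    show "(\<lambda>_. Mq * Mv) integrable_on {a..b}" by (rule integrable_const_ivl)
    show "norm (V n t) \<le> Mq * Mv" if t: "t \<in> {a..b}" for n t
    proof -
      have "\<bar>forward_mean q' (h n) t\<bar> \<le> Mq"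
        by (rule forward_mean_bound[OF q' h(1)]) (use t h(3)[of n] in \<open>auto intro!: Mq(2)\<close>)
      moreover have "\<bar>forward_mean v (h n) t\<bar> \<le> Mv"
        by (rule forward_mean_bound[OF v h(1)]) (use t h(3)[of n] in \<open>auto intro!: Mv(2)\<close>)
      ultimately show ?thesis unfolding V_def by (auto simp: abs_mult intro!: mult_mono Mq(1))
    qed
    show "(\<lambda>n. V n t) \<longlonglongrightarrow> q' t * v t" for t
      unfolding V_def by (intro tendsto_intros forward_mean_tendsto v q' h)
  qed
  ultimately show ?thesis by (rule LIMSEQ_le) (use W_le in auto)
qed

section \<open>Cauchy-Schwarz and Gronwall inequalities\<close>

text \<open>Cauchy-Schwarz against the constant 1: the integral of the squared deviation of
  \<open>f\<close> from its mean \<open>m\<close> is nonnegative.\<close>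

lemma integral_square_le:
  fixes f :: "real \<Rightarrow> real"
  assumes ab: "a \<le> b" and f: "continuous_on {a..b} f"
  shows "(integral {a..b} f)\<^sup>2 \<le> (b - a) * integral {a..b} (\<lambda>x. (f x)\<^sup>2)"
proof (cases "a = b")
  case False
  define l where "l = b - a"
  have l: "0 < l" using False ab by (simp add: l_def)
  define I where "I = integral {a..b} f"
  define J where "J = integral {a..b} (\<lambda>x. (f x)\<^sup>2)"
  have I: "(f has_integral I) {a..b}" and J: "((\<lambda>x. (f x)\<^sup>2) has_integral J) {a..b}"
    unfolding I_def J_def by (intro integrable_integral integrable_continuous_interval continuous_intros f)+
  define m where "m = I / l"
  have "((\<lambda>x. (f x)\<^sup>2 - (2 * m) * f x + m\<^sup>2) has_integral J - (2 * m) * I + l * m\<^sup>2) {a..b}"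
    using has_integral_const_real[of "m\<^sup>2" a b] l
    by (intro has_integral_add has_integral_diff has_integral_mult_right I J) (simp add: l_def)
  then have "0 \<le> J - (2 * m) * I + l * m\<^sup>2"
  proof (rule has_integral_nonneg)
    show "0 \<le> (f x)\<^sup>2 - (2 * m) * f x + m\<^sup>2" for x
      using zero_le_power2[of "f x - m"] by (simp add: power2_eq_square algebra_simps)
  qed
  also have "\<dots> = J - I\<^sup>2 / l" using l by (simp add: m_def power2_eq_square field_simps)
  finally show ?thesis using l by (simp add: l_def I_def J_def field_simps)
qed simp

lemma gronwall_integral:
  fixes Z :: "real \<Rightarrow> real"
  assumes r: "0 < r" and Z: "continuous_on {0..} Z" and t: "0 \<le> t"
    and le: "\<And>a b. 0 \<le> a \<Longrightarrow> a \<le> b \<Longrightarrow> Z b - Z a \<le> - r * integral {a..b} Z"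
  shows "Z t \<le> Z 0 * exp (- r * t)"
proof -
  define I where "I \<tau> = integral {0..\<tau>} Z" for \<tau>
  define N where "N \<tau> = Z \<tau> + r * I \<tau>" for \<tau>
  have Zc: "continuous_on {0..t} Z" by (rule continuous_on_subset[OF Z]) auto
  have N_dec: "N b \<le> N a" if "0 \<le> a" "a \<le> b" "b \<le> t" for a b
  proof -
    have "integral {0..a} Z + integral {a..b} Z = integral {0..b} Z"
      by (rule Henstock_Kurzweil_Integration.integral_combine)
        (use that in \<open>auto intro!: integrable_continuous_interval continuous_on_subset[OF Z]\<close>)
    then have "integral {a..b} Z = I b - I a" by (simp add: I_def)
    with le[OF that(1,2)] show ?thesis by (simp add: N_def algebra_simps)
  qed
  have "((\<lambda>\<tau>. exp (r * \<tau>) * (N \<tau> - N t)) has_integral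
      (exp (r * t) * I t - N t * (exp (r * t) / r)) - (exp (r * 0) * I 0 - N t * (exp (r * 0) / r))) {0..t}"
  proof (rule fundamental_theorem_of_calculus[OF t])
    fix \<tau> assume \<tau>: "\<tau> \<in> {0..t}"
    have e: "((\<lambda>\<tau>. exp (r * \<tau>)) has_real_derivative r * exp (r * \<tau>)) (at \<tau> within {0..t})"
      by (auto intro!: derivative_eq_intros)
    have "(I has_real_derivative Z \<tau>) (at \<tau> within {0..t})"
      unfolding I_def[abs_def] by (rule integral_has_real_derivative[OF Zc \<tau>])
    from DERIV_diff[OF DERIV_mult[OF e this] DERIV_cmult[OF DERIV_cdivide[OF e, of r], of "N t"]] r
    show "((\<lambda>\<tau>. exp (r * \<tau>) * I \<tau> - N t * (exp (r * \<tau>) / r)) has_vector_derivative exp (r * \<tau>) * (N \<tau> - N t)) (at \<tau> within {0..t})"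
      unfolding has_real_derivative_iff_has_vector_derivative by (simp add: N_def algebra_simps)
  qed
  then have "0 \<le> (exp (r * t) * I t - N t * (exp (r * t) / r)) - (exp (r * 0) * I 0 - N t * (exp (r * 0) / r))"
    by (rule has_integral_nonneg) (use N_dec t in auto)
  then have "0 \<le> exp (r * t) * I t - N t * (exp (r * t) / r) + N t / r" by (simp add: I_def)
  then have "0 \<le> r * (exp (r * t) * I t - N t * (exp (r * t) / r) + N t / r)" using r by simp
  also have "\<dots> = r * (exp (r * t) * I t) - N t * exp (r * t) + N t" using r by (simp add: field_simps)
  also have "\<dots> = N t - exp (r * t) * Z t" by (simp add: N_def algebra_simps)
  finally have "exp (r * t) * Z t \<le> N 0" using N_dec[of 0 t] t by simp
  then show ?thesis by (simp add: N_def I_def exp_minus field_simps)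
qed

subsection \<open>The closed loop\<close>

text \<open>The parameter space is general because \<open>z\<close> is a time in
  \<open>integral_cont\<close> but a pair of times in \<open>grad_kernel_cont\<close>.\<close>

lemma continuous_on_moving_integral:
  fixes f :: "real \<Rightarrow> 'z::t2_space \<Rightarrow> real" and l :: "'z \<Rightarrow> real"
  assumes f: "continuous_on {(x, z). z \<in> S \<and> 0 \<le> x \<and> x \<le> l z} (\<lambda>(x, z). f x z)"
    and l: "continuous_on S l" "\<And>z. z \<in> S \<Longrightarrow> 0 < l z"
  shows "continuous_on S (\<lambda>z. integral {0..l z} (\<lambda>x. f x z))"
proof -
  have "continuous_on (S \<times> cbox 0 1) (\<lambda>y. case (snd y * l (fst y), fst y) of (x, z) \<Rightarrow> f x z)"
  proof (rule continuous_on_compose2[OF f])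
    show "continuous_on (S \<times> cbox 0 1) (\<lambda>y. (snd y * l (fst y), fst y))"
      by (intro continuous_intros continuous_on_compose2[OF l(1)]) auto
    show "(\<lambda>y. (snd y * l (fst y), fst y)) ` (S \<times> cbox 0 1) \<subseteq> {(x, z). z \<in> S \<and> 0 \<le> x \<and> x \<le> l z}"
      by (auto intro!: mult_nonneg_nonneg mult_left_le_one_le less_imp_le[OF l(2)])
  qed
  then have "continuous_on S (\<lambda>z. integral (cbox 0 1) (\<lambda>\<xi>. f (\<xi> * l z) z))"
    by (intro integral_continuous_on_param) (simp add: case_prod_unfold)
  then have "continuous_on S (\<lambda>z. l z * integral {0..1} (\<lambda>\<xi>. f (\<xi> * l z) z))"
    by (intro continuous_on_mult l(1)) simp
  then show ?thesis
    by (rule continuous_on_eq) (simp add: integral_rescale_unit[OF l(2)])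
qed

lemma eq_at_0_if_eq_pos:
  fixes f g :: "real \<Rightarrow> real"
  assumes "continuous_on {0..} f" "continuous_on {0..} g" "\<And>t. 0 < t \<Longrightarrow> f t = g t" "0 \<le> t"
  shows "f t = g t"
proof -
  have "f t - g t = 0"
    by (rule continuous_constant_on_closure[of "{0<..}" "\<lambda>t. f t - g t"])
      (use assms in \<open>auto intro!: continuous_intros\<close>)
  then show ?thesis by simp
qed

text \<open>Here \<open>u\<close> stands for the temperature above melting and \<open>p\<close> for
  its space derivative, one-sided at both ends. The assumption \<open>setpoint\<close> is the
  condition on \<open>sr\<close> divided by \<beta>; it states that the initial
  \<open>energy\<close> is negative.\<close>

locale stefan_loop =
  fixes \<alpha> \<beta> c sr :: real and s s' :: "real \<Rightarrow> real" and u p ut :: "real \<Rightarrow> real \<Rightarrow> real"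
  assumes \<alpha>: "0 < \<alpha>" and \<beta>: "0 < \<beta>" and c: "0 < c"
    and s_pos: "\<And>t. 0 \<le> t \<Longrightarrow> 0 < s t"
    and s_deriv: "\<And>t. 0 \<le> t \<Longrightarrow> (s has_real_derivative s' t) (at t within {0..})"
    and s'_cont: "continuous_on {0..} s'"
    and stefan_pos: "\<And>t. 0 < t \<Longrightarrow> s' t = - \<beta> * p (s t) t"
    and u_cont: "continuous_on (closed_liquid s) (\<lambda>(x, t). u x t)"
    and p_cont: "continuous_on (closed_liquid s) (\<lambda>(x, t). p x t)"
    and u_deriv: "\<And>x t. (x, t) \<in> closed_liquid s \<Longrightarrow>
      ((\<lambda>y. u y t) has_real_derivative p x t) (at x within {0..s t})"
    and ut_cont: "continuous_on (open_liquid s) (\<lambda>(x, t). ut x t)"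
    and u_t: "\<And>x t. (x, t) \<in> open_liquid s \<Longrightarrow> ((\<lambda>\<tau>. u x \<tau>) has_real_derivative ut x t) (at t)"
    and heat: "\<And>x t. (x, t) \<in> open_liquid s \<Longrightarrow> ((\<lambda>y. p y t) has_real_derivative ut x t / \<alpha>) (at x)"
    and flux_pos: "\<And>t. 0 < t \<Longrightarrow>
      p 0 t = c * (1 / \<alpha> * integral {0..s t} (\<lambda>x. u x t) + 1 / \<beta> * (s t - sr))"
    and melting: "\<And>t. 0 \<le> t \<Longrightarrow> u (s t) t = 0"
    and init_nonneg: "\<And>x. 0 \<le> x \<Longrightarrow> x \<le> s 0 \<Longrightarrow> 0 \<le> u x 0"
    and setpoint: "1 / \<alpha> * integral {0..s 0} (\<lambda>x. u x 0) + 1 / \<beta> * (s 0 - sr) < 0"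
begin

text \<open>Sensible plus latent heat divided by the conductivity, measured from the target state
  \<open>u = 0\<close>, \<open>s = sr\<close>. The control law feeds back exactly this
  quantity.\<close>

definition energy :: "real \<Rightarrow> real" where
  "energy t = 1 / \<alpha> * integral {0..s t} (\<lambda>x. u x t) + 1 / \<beta> * (s t - sr)"

text \<open>Defined by the explicit exponential and not as \<open>- p 0 t\<close>, so that it is
  smooth on the whole line, as \<open>kernel_energy_le\<close> demands of \<open>q\<close>. The two
  are identified for nonnegative times in \<open>flux_eq\<close>.\<close>

definition influx :: "real \<Rightarrow> real" where
  "influx t = - c * energy 0 * exp (- c * t)"

section \<open>Regularity on the liquid region\<close>

lemma s_cont: "continuous_on {0..} s"
  using s_deriv by (intro DERIV_continuous_on) auto

lemma s_DERIV: "(s has_real_derivative s' t) (at t)" if "0 < t"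
proof -
  have "(s has_real_derivative s' t) (at t within {0<..})"
    using s_deriv[of t] that by (auto intro: has_field_derivative_subset)
  then show ?thesis using that by (simp add: at_within_open[of t "{0<..}"])
qed

lemma u_DERIV: "((\<lambda>y. u y t) has_real_derivative p x t) (at x)" if "0 \<le> t" "0 < x" "x < s t"
proof -
  have "((\<lambda>y. u y t) has_real_derivative p x t) (at x within {0<..<s t})"
    using u_deriv[of x t] that by (auto simp: closed_liquid_def intro: has_field_derivative_subset)
  then show ?thesis using that by (simp add: at_within_open[of x "{0<..<s t}"])
qed

lemma continuous_on_along:
  fixes f :: "real \<Rightarrow> real \<Rightarrow> real"
  assumes f: "continuous_on (closed_liquid s) (\<lambda>(x, t). f x t)"
    and g: "continuous_on A g" "continuous_on A h" "\<And>z. z \<in> A \<Longrightarrow> 0 \<le> h z \<and> 0 \<le> g z \<and> g z \<le> s (h z)"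
  shows "continuous_on A (\<lambda>z. f (g z) (h z))"
  using continuous_on_compose2[OF f continuous_on_Pair[OF g(1,2)]] g(3)
  by (auto simp: closed_liquid_def)

lemma slice_cont:
  fixes f :: "real \<Rightarrow> real \<Rightarrow> real"
  assumes "continuous_on (closed_liquid s) (\<lambda>(x, t). f x t)" "0 \<le> t" "l \<le> s t"
  shows "continuous_on {0..l} (\<lambda>x. f x t)"
  by (rule continuous_on_along[OF assms(1)]) (use assms in \<open>auto intro!: continuous_intros\<close>)

lemma integral_cont:
  fixes f :: "real \<Rightarrow> real \<Rightarrow> real"
  assumes "continuous_on (closed_liquid s) (\<lambda>(x, t). f x t)"
  shows "continuous_on {0..} (\<lambda>t. integral {0..s t} (\<lambda>x. f x t))"
  by (rule continuous_on_moving_integral)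
    (use assms s_cont s_pos in \<open>auto simp: closed_liquid_def\<close>)

lemma energy_cont: "continuous_on {0..} energy"
  unfolding energy_def by (intro continuous_intros integral_cont u_cont s_cont)

lemma interface_cont:
  fixes f :: "real \<Rightarrow> real \<Rightarrow> real"
  assumes f: "continuous_on (closed_liquid s) (\<lambda>(x, t). f x t)"
  shows "continuous_on {0..} (\<lambda>t. f (s t) t)" "continuous_on {0..} (\<lambda>t. f 0 t)"
  by (rule continuous_on_along[OF f]; use s_pos in \<open>auto intro!: continuous_intros s_cont less_imp_le\<close>)+

section \<open>Boundary equations and the energy law\<close>

lemma stefan: "p (s t) t = - s' t / \<beta>" if "0 \<le> t"
proof (rule eq_at_0_if_eq_pos[OF _ _ _ that])
  show "continuous_on {0..} (\<lambda>t. - s' t / \<beta>)" using \<beta> by (intro continuous_intros s'_cont) auto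
  show "p (s t) t = - s' t / \<beta>" if "0 < t" for t using stefan_pos[OF that] \<beta> by simp
qed (rule interface_cont[OF p_cont])

lemma flux: "p 0 t = c * energy t" if "0 \<le> t"
proof (rule eq_at_0_if_eq_pos[OF _ _ _ that])
  show "continuous_on {0..} (\<lambda>t. c * energy t)" by (intro continuous_intros energy_cont)
  show "p 0 t = c * energy t" if "0 < t" for t using flux_pos[OF that] by (simp add: energy_def)
qed (rule interface_cont[OF p_cont])

text \<open>Weak form of the heat equation for a test function independent of time. The regularity
  asked of \<open>\<phi>\<close> is that of a temperature profile at a fixed time, and
  \<open>r\<close> may follow the interface or stay constant; both options are combined in
  \<open>grad_kernel_increment_le\<close>.\<close>

lemma test_balance:
  assumes ab: "0 \<le> a" "a \<le> b"
    and r: "\<And>t. t \<in> {a..b} \<Longrightarrow> 0 < r t \<and> r t \<le> s t \<and> r t \<le> L" "continuous_on {a..b} r" "continuous_on {a..b} r'"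
      "\<And>t. t \<in> {a<..<b} \<Longrightarrow> (r has_real_derivative r' t) (at t)"
    and \<phi>: "continuous_on {0..L} \<phi>" "continuous_on {0..L} \<phi>'"
      "\<And>x. 0 < x \<Longrightarrow> x < L \<Longrightarrow> (\<phi> has_real_derivative \<phi>' x) (at x)"
  shows "((\<lambda>t. r' t * (u (r t) t * \<phi> (r t)) + \<alpha> * p (r t) t * \<phi> (r t) - \<alpha> * p 0 t * \<phi> 0
      - integral {0..r t} (\<lambda>x. \<alpha> * (p x t * \<phi>' x))) has_integral
      integral {0..r b} (\<lambda>x. u x b * \<phi> x) - integral {0..r a} (\<lambda>x. u x a * \<phi> x)) {a..b}"
proof (rule moving_domain_balance[where w="\<lambda>x t. u x t * \<phi> x" and G="\<lambda>x t. \<alpha> * p x t * \<phi> x" and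
      R="\<lambda>x t. \<alpha> * (p x t * \<phi>' x)" and wx="\<lambda>x t. p x t * \<phi> x + u x t * \<phi>' x" and wt="\<lambda>x t. ut x t * \<phi> x"])
  let ?D = "{(x, t). t \<in> {a..b} \<and> 0 \<le> x \<and> x \<le> r t}" and ?Q = "{(x, t). t \<in> {a<..<b} \<and> 0 < x \<and> x < r t}"
  have inD: "0 \<le> t \<and> 0 \<le> x \<and> x \<le> s t \<and> x \<le> L" if "(x, t) \<in> ?D" for x t
    using that ab r(1)[of t] by auto
  have inQ: "(x, t) \<in> open_liquid s" "(x, t) \<in> ?D" "0 < t" "0 < x" "x < s t" "x < L" if "(x, t) \<in> ?Q" for x t
    using that ab r(1)[of t] by (auto simp: open_liquid_def)
  have sub: "?D \<subseteq> closed_liquid s" using inD by (auto simp: closed_liquid_def)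
  have subQ: "?Q \<subseteq> ?D" by auto
  have subQ': "?Q \<subseteq> open_liquid s" using inQ(1) by auto
  have c1: "continuous_on ?D (\<lambda>z. u (fst z) (snd z))" and c2: "continuous_on ?D (\<lambda>z. p (fst z) (snd z))"
    using continuous_on_subset[OF u_cont sub] continuous_on_subset[OF p_cont sub] by (simp_all add: case_prod_unfold)
  have c3: "continuous_on ?D (\<lambda>z. \<phi> (fst z))"
    by (rule continuous_on_compose2[OF \<phi>(1)]) (use inD in \<open>auto intro!: continuous_intros\<close>)
  have c4: "continuous_on ?D (\<lambda>z. \<phi>' (fst z))"
    by (rule continuous_on_compose2[OF \<phi>(2)]) (use inD in \<open>auto intro!: continuous_intros\<close>)
  have c5: "continuous_on ?Q (\<lambda>z. ut (fst z) (snd z))"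
    using continuous_on_subset[OF ut_cont subQ'] by (simp add: case_prod_unfold)
  note Q = c1[THEN continuous_on_subset, OF subQ] c2[THEN continuous_on_subset, OF subQ]
    c3[THEN continuous_on_subset, OF subQ] c4[THEN continuous_on_subset, OF subQ]
  have "continuous_on ?D (\<lambda>z. u (fst z) (snd z) * \<phi> (fst z))" "continuous_on ?D (\<lambda>z. \<alpha> * p (fst z) (snd z) * \<phi> (fst z))"
    "continuous_on ?D (\<lambda>z. \<alpha> * (p (fst z) (snd z) * \<phi>' (fst z)))"
    by (intro continuous_on_mult continuous_on_const c1 c2 c3 c4)+
  then show "continuous_on ?D (\<lambda>(x, t). u x t * \<phi> x)" "continuous_on ?D (\<lambda>(x, t). \<alpha> * p x t * \<phi> x)"
    "continuous_on ?D (\<lambda>(x, t). \<alpha> * (p x t * \<phi>' x))"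
    by (simp_all add: case_prod_unfold)
  have "continuous_on ?Q (\<lambda>z. p (fst z) (snd z) * \<phi> (fst z) + u (fst z) (snd z) * \<phi>' (fst z))"
    "continuous_on ?Q (\<lambda>z. ut (fst z) (snd z) * \<phi> (fst z))"
    by (intro continuous_on_mult continuous_on_add c5 Q)+
  then show "continuous_on ?Q (\<lambda>(x, t). p x t * \<phi> x + u x t * \<phi>' x)" "continuous_on ?Q (\<lambda>(x, t). ut x t * \<phi> x)"
    by (simp_all add: case_prod_unfold)
  fix x t assume xt: "(x, t) \<in> ?Q"
  note i = inQ[OF xt]
  have d: "((\<lambda>y. u y t) has_real_derivative p x t) (at x)" using u_DERIV i by auto
  have d2: "(\<phi> has_real_derivative \<phi>' x) (at x)" using \<phi>(3) i by auto
  show "((\<lambda>y. u y t * \<phi> y) has_real_derivative p x t * \<phi> x + u x t * \<phi>' x) (at x)"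
    using DERIV_mult[OF d d2] by (simp add: mult.commute)
  show "((\<lambda>\<tau>. u x \<tau> * \<phi> x) has_real_derivative ut x t * \<phi> x) (at t)"
    using DERIV_cmult_right[OF u_t[OF i(1)]] .
  show "((\<lambda>y. \<alpha> * p y t * \<phi> y) has_real_derivative ut x t * \<phi> x + \<alpha> * (p x t * \<phi>' x)) (at x)"
    using DERIV_mult[OF DERIV_cmult[OF heat[OF i(1)], of \<alpha>] d2] \<alpha> by (simp add: ac_simps)
qed (use ab r in auto)

lemma s_conditions:
  assumes "0 \<le> a"
  shows "continuous_on {a..b} s" "continuous_on {a..b} s'"
    "\<And>t. t \<in> {a<..<b} \<Longrightarrow> (s has_real_derivative s' t) (at t)"
  using assms by (auto intro: continuous_on_subset[OF s_cont] continuous_on_subset[OF s'_cont] s_DERIV)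

text \<open>With test function 1, the heat leaving through the interface is
  \<open>(\<alpha> / \<beta>) * s' t\<close>; after division by \<alpha> it cancels the growth of
  the latent heat. Only the flux at the left end survives, and the control makes it proportional to
  the energy.\<close>

lemma energy_balance:
  assumes ab: "0 \<le> a" "a \<le> b"
  shows "((\<lambda>t. - c * energy t) has_integral energy b - energy a) {a..b}"
proof -
  obtain L where L: "\<And>t. t \<in> {a..b} \<Longrightarrow> s t \<le> L"
  proof -
    have "bounded (s ` {a..b})"
      by (intro compact_imp_bounded compact_continuous_image s_conditions ab compact_Icc)
    then obtain M where "\<forall>t\<in>{a..b}. \<bar>s t\<bar> \<le> M" by (auto simp: bounded_iff)
    then show ?thesis by (intro that[of M]) fastforce
  qed
  have "((\<lambda>t. s' t * (u (s t) t * 1) + \<alpha> * p (s t) t * 1 - \<alpha> * p 0 t * 1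
      - integral {0..s t} (\<lambda>x. \<alpha> * (p x t * 0))) has_integral
      integral {0..s b} (\<lambda>x. u x b * 1) - integral {0..s a} (\<lambda>x. u x a * 1)) {a..b}"
    by (rule test_balance[OF ab, where L=L]) (use L s_conditions[OF ab(1), where b=b] ab s_pos in auto)
  then have 1: "((\<lambda>t. - (\<alpha> / \<beta>) * s' t - \<alpha> * c * energy t) has_integral
      integral {0..s b} (\<lambda>x. u x b) - integral {0..s a} (\<lambda>x. u x a)) {a..b}"
    by (rule has_integral_eq_rhs[OF has_integral_eq[rotated]]) (use ab in \<open>auto simp: melting stefan flux\<close>)
  have 2: "(s' has_integral s b - s a) {a..b}"
    by (rule fundamental_theorem_of_calculus_interior[OF ab(2)])
      (use s_conditions[OF ab(1), where b=b] in \<open>auto simp: has_real_derivative_iff_has_vector_derivative\<close>)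
  have "((\<lambda>t. 1 / \<alpha> * (- (\<alpha> / \<beta>) * s' t - \<alpha> * c * energy t) + 1 / \<beta> * s' t) has_integral
     1 / \<alpha> * (integral {0..s b} (\<lambda>x. u x b) - integral {0..s a} (\<lambda>x. u x a)) + 1 / \<beta> * (s b - s a)) {a..b}"
    by (intro has_integral_add has_integral_mult_right 1 2)
  moreover have "1 / \<alpha> * (- (\<alpha> / \<beta>) * s' t - \<alpha> * c * energy t) + 1 / \<beta> * s' t = - c * energy t" for t
    using \<alpha> \<beta> by (simp add: field_simps)
  moreover have "1 / \<alpha> * (integral {0..s b} (\<lambda>x. u x b) - integral {0..s a} (\<lambda>x. u x a)) + 1 / \<beta> * (s b - s a) = energy b - energy a"
    by (simp add: energy_def algebra_simps)
  ultimately show ?thesis by simp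
qed

lemma energy_eq: "energy t = energy 0 * exp (- c * t)" if t: "0 \<le> t"
proof -
  have d: "(energy has_real_derivative - c * energy \<tau>) (at \<tau> within {0..t})" if \<tau>: "\<tau> \<in> {0..t}" for \<tau>
  proof -
    have "((\<lambda>\<tau>. energy 0 + integral {0..\<tau>} (\<lambda>t. - c * energy t)) has_real_derivative - c * energy \<tau>) (at \<tau> within {0..t})"
      by (rule derivative_eq_intros integral_has_real_derivative refl)+
        (use \<tau> in \<open>auto intro!: continuous_intros continuous_on_subset[OF energy_cont]\<close>)
    note 1 = this
    have 2: "energy \<sigma> = energy 0 + integral {0..\<sigma>} (\<lambda>t. - c * energy t)" if "\<sigma> \<in> {0..t}" for \<sigma>
      using integral_unique[OF energy_balance[of 0 \<sigma>]] that by simp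
    show ?thesis
      by (rule has_field_derivative_transform_within[OF 1 zero_less_one \<tau>]) (rule 2[symmetric])
  qed
  have "\<exists>C. \<forall>\<tau>\<in>{0..t}. energy \<tau> * exp (c * \<tau>) = C"
  proof (rule has_field_derivative_zero_constant)
    show "((\<lambda>\<tau>. energy \<tau> * exp (c * \<tau>)) has_real_derivative 0) (at \<tau> within {0..t})" if "\<tau> \<in> {0..t}" for \<tau>
    proof -
      have "((\<lambda>\<tau>. exp (c * \<tau>)) has_real_derivative c * exp (c * \<tau>)) (at \<tau> within {0..t})"
        by (auto intro!: derivative_eq_intros)
      from DERIV_mult[OF d[OF that] this] show ?thesis by (simp add: ac_simps)
    qed
  qed simp
  then have "energy t * exp (c * t) = energy 0 * exp (c * 0)" using t by force
  then show ?thesis by (simp add: exp_minus field_simps)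
qed

section \<open>Sign of the temperature and monotonicity of the interface\<close>

lemma influx_pos: "0 < influx t"
  using setpoint c by (simp add: influx_def energy_def mult_less_0_iff mult_pos_neg)

lemma flux_eq: "p 0 t = - influx t" if "0 \<le> t"
  using flux[OF that] energy_eq[OF that] by (simp add: influx_def)

text \<open>At a negative minimum of \<open>u + \<epsilon> t\<close>, the strict sign \<open>u\<^sub>x(0, t) < 0\<close> excludes the left end.\<close>

lemma u_nonneg: "0 \<le> u x t" if "0 \<le> t" "0 \<le> x" "x \<le> s t"
proof (rule ccontr)
  \<comment> \<open>With this choice
    \<open>u x t + \<epsilon> * t = u x t * (t + 2) / (2 * (t + 1))\<close>, which is still
    negative; \<open>t + 1\<close> in the denominator admits \<open>t = 0\<close>.\<close>
  define \<epsilon> where "\<epsilon> = - u x t / (2 * (t + 1))"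
  assume "\<not> 0 \<le> u x t"
  then have neg: "u x t < 0" by simp
  then have "t * u x t \<le> 0" using that by (simp add: mult_nonneg_nonpos)
  with neg have \<epsilon>: "0 < \<epsilon>" "u x t + \<epsilon> * t < 0"
    using that by (auto simp: \<epsilon>_def field_simps mult_less_0_iff)
  define C where "C = {(x, \<tau>). \<tau> \<in> {0..t} \<and> 0 \<le> x \<and> x \<le> s \<tau>}"
  have C_sub: "C \<subseteq> closed_liquid s" by (auto simp: C_def closed_liquid_def)
  \<comment> \<open>Rescaling in space exhibits the region as the continuous image of a rectangle,
    hence as a compact set.\<close>
  have "C = (\<lambda>z. (snd z * s (fst z), fst z)) ` ({0..t} \<times> {0..1})"
  proof (intro equalityI subsetI)
    fix z assume z: "z \<in> C"
    then have "0 < s (snd z)" using s_pos by (auto simp: C_def)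
    then have "z = (snd (snd z, fst z / s (snd z)) * s (fst (snd z, fst z / s (snd z))), fst (snd z, fst z / s (snd z)))"
      "(snd z, fst z / s (snd z)) \<in> {0..t} \<times> {0..1}"
      using z by (auto simp: C_def)
    then show "z \<in> (\<lambda>z. (snd z * s (fst z), fst z)) ` ({0..t} \<times> {0..1})" by (rule image_eqI)
  qed (auto simp: C_def intro!: mult_nonneg_nonneg mult_left_le_one_le less_imp_le[OF s_pos])
  moreover have "continuous_on ({0..t} \<times> {0..1::real}) (\<lambda>z. (snd z * s (fst z), fst z))"
    by (intro continuous_intros continuous_on_compose2[OF s_cont]) auto
  ultimately have "compact C"
    by (simp add: compact_continuous_image compact_Times)
  moreover have "(x, t) \<in> C" using that by (auto simp: C_def)
  moreover have "continuous_on C (\<lambda>z. u (fst z) (snd z) + \<epsilon> * snd z)"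
    using continuous_on_subset[OF u_cont C_sub] by (intro continuous_intros) (simp add: case_prod_unfold)
  ultimately obtain z where z: "z \<in> C" "\<And>y. y \<in> C \<Longrightarrow> u (fst z) (snd z) + \<epsilon> * snd z \<le> u (fst y) (snd y) + \<epsilon> * snd y"
    using continuous_attains_inf[of C "\<lambda>z. u (fst z) (snd z) + \<epsilon> * snd z"] by blast
  obtain x1 t1 where x1: "z = (x1, t1)" by (cases z)
  have r: "0 \<le> t1" "t1 \<le> t" "0 \<le> x1" "x1 \<le> s t1" using z(1) by (auto simp: x1 C_def)
  have min: "u x1 t1 + \<epsilon> * t1 \<le> u y \<tau> + \<epsilon> * \<tau>" if "0 \<le> \<tau>" "\<tau> \<le> t" "0 \<le> y" "y \<le> s \<tau>" for y \<tau>
    using z(2)[of "(y, \<tau>)"] that by (auto simp: x1 C_def)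
  have v_neg: "u x1 t1 + \<epsilon> * t1 < 0" using min[of t x] \<epsilon> that by simp
  then have u_neg: "u x1 t1 < 0" using \<epsilon>(1) r(1) by (smt (verit) mult_nonneg_nonneg)
  have t1: "0 < t1" using u_neg init_nonneg[of x1] r by (cases "t1 = 0") auto
  have x1_less: "x1 < s t1" using u_neg melting[of t1] r by (cases "x1 = s t1") auto
  have min_x: "u x1 t1 \<le> u y t1" if "0 \<le> y" "y \<le> s t1" for y
    using min[of t1 y] that r by simp
  show False
  proof (cases "x1 = 0")
    case True
    have "((\<lambda>y. u y t1) has_real_derivative p 0 t1) (at 0 within {0..s t1})"
      using u_deriv[of 0 t1] r True by (auto simp: closed_liquid_def)
    moreover have "p 0 t1 < 0" using flux_eq[of t1] influx_pos[of t1] r by simp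
    ultimately obtain d where d: "d > 0" "\<And>h. h > 0 \<Longrightarrow> 0 + h \<in> {0..s t1} \<Longrightarrow> h < d \<Longrightarrow> u (0 + h) t1 < u 0 t1"
      using has_real_derivative_neg_dec_right by blast
    define h where "h = min (d / 2) (s t1)"
    have "u h t1 < u 0 t1" using d(2)[of h] d(1) s_pos[OF r(1)] by (auto simp: h_def)
    moreover have "u 0 t1 \<le> u h t1" using min_x[of h] d(1) s_pos[OF r(1)] True by (auto simp: h_def)
    ultimately show False by simp
  next
    case False
    then have x1_pos: "0 < x1" using r by simp
    have in_open: "(x1, t1) \<in> open_liquid s" using t1 x1_less x1_pos by (auto simp: open_liquid_def)
    have p0: "p x1 t1 = 0"
    proof (rule DERIV_local_min[OF u_DERIV[OF r(1) x1_pos x1_less], of "min x1 (s t1 - x1)"])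
      show "\<forall>y. \<bar>x1 - y\<bar> < min x1 (s t1 - x1) \<longrightarrow> u x1 t1 \<le> u y t1"
        by (auto intro!: min_x)
    qed (use x1_pos x1_less in auto)
    \<comment> \<open>Only earlier times are compared, since \<open>t1 = t\<close> is possible.
      Continuity of \<open>s\<close> keeps \<open>x1\<close> inside the liquid shortly before
      \<open>t1\<close>.\<close>
    have "ut x1 t1 + \<epsilon> \<le> 0"
    proof (rule ccontr)
      assume "\<not> ut x1 t1 + \<epsilon> \<le> 0"
      then have l: "0 < ut x1 t1 + \<epsilon>" by simp
      have "((\<lambda>\<tau>. u x1 \<tau> + \<epsilon> * \<tau>) has_real_derivative ut x1 t1 + \<epsilon>) (at t1)"
        using DERIV_add[OF u_t[OF in_open] DERIV_cmult[OF DERIV_ident, of \<epsilon>]] by simp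
      from DERIV_pos_inc_left[OF this l] obtain d where d: "d > 0"
        "\<And>h. h > 0 \<Longrightarrow> h < d \<Longrightarrow> u x1 (t1 - h) + \<epsilon> * (t1 - h) < u x1 t1 + \<epsilon> * t1"
        by blast
      have "isCont s t1" using s_DERIV[OF t1] by (rule DERIV_isCont)
      then have "\<forall>\<^sub>F \<tau> in at t1. x1 < s \<tau>" using x1_less by (intro order_tendstoD) (auto simp: isCont_def)
      then obtain e where e: "e > 0" "\<And>\<tau>. \<tau> \<noteq> t1 \<Longrightarrow> dist \<tau> t1 < e \<Longrightarrow> x1 < s \<tau>"
        unfolding eventually_at by auto
      define h where "h = min (min (d / 2) (e / 2)) t1"
      have h: "0 < h" "h < d" "h < e" "h \<le> t1" using d e t1 by (auto simp: h_def)
      have "x1 < s (t1 - h)" using e(2)[of "t1 - h"] h by (auto simp: dist_real_def)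
      then have "u x1 t1 + \<epsilon> * t1 \<le> u x1 (t1 - h) + \<epsilon> * (t1 - h)" using h r by (intro min) auto
      with d(2)[of h] h show False by simp
    qed
    \<comment> \<open>By the heat equation, \<open>p\<close> decreases strictly through its zero at
      \<open>x1\<close>, so \<open>u\<close> falls to the right of \<open>x1\<close>, against
      minimality in space.\<close>
    then have "ut x1 t1 / \<alpha> < 0" using \<epsilon>(1) \<alpha> by (simp add: divide_neg_pos)
    with heat[OF in_open] obtain d where d: "d > 0" "\<And>h. h > 0 \<Longrightarrow> h < d \<Longrightarrow> p (x1 + h) t1 < p x1 t1"
      using DERIV_neg_dec_right by blast
    define h where "h = min (d / 2) ((s t1 - x1) / 2)"
    have h: "0 < h" "h < d" "x1 + h < s t1" using d x1_less by (auto simp: h_def min_def field_simps)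
    obtain \<xi> where \<xi>: "x1 < \<xi>" "\<xi> < x1 + h" "u (x1 + h) t1 - u x1 t1 = (x1 + h - x1) * p \<xi> t1"
      using MVT2[of x1 "x1 + h" "\<lambda>y. u y t1" "\<lambda>y. p y t1"] u_DERIV[OF r(1)] x1_pos h by auto
    have "p \<xi> t1 < 0" using d(2)[of "\<xi> - x1"] \<xi> h p0 by auto
    then have "u (x1 + h) t1 < u x1 t1" using \<xi>(3) h by (smt (verit) mult_pos_neg)
    with min_x[of "x1 + h"] h x1_pos show False by auto
  qed
qed

text \<open>A positive slope at the zero \<open>s t\<close> would make the nonnegative
  \<open>u\<close> negative just to the left of it.\<close>

lemma p_interface_nonpos: "p (s t) t \<le> 0" if t: "0 \<le> t"
proof (rule ccontr)
  assume "\<not> p (s t) t \<le> 0"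
  moreover have "((\<lambda>y. u y t) has_real_derivative p (s t) t) (at (s t) within {0..s t})"
    using u_deriv[of "s t" t] t s_pos[OF t] by (auto simp: closed_liquid_def)
  ultimately obtain d where d: "d > 0" "\<And>h. h > 0 \<Longrightarrow> s t - h \<in> {0..s t} \<Longrightarrow> h < d \<Longrightarrow> u (s t - h) t < u (s t) t"
    using has_real_derivative_pos_inc_left by (metis not_le)
  define h where "h = min (d / 2) (s t)"
  have h: "0 < h" "h < d" "h \<le> s t" using d s_pos[OF t] by (auto simp: h_def)
  have "u (s t - h) t < 0" using d(2)[of h] h melting[OF t] by auto
  with u_nonneg[OF t, of "s t - h"] h show False by auto
qed

lemma s_mono: "s a \<le> s b" if "0 \<le> a" "a \<le> b"
proof -
  have "(s' has_integral s b - s a) {a..b}"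
    by (rule fundamental_theorem_of_calculus_interior[OF that(2)])
      (use s_conditions[OF that(1), where b=b] in \<open>auto simp: has_real_derivative_iff_has_vector_derivative\<close>)
  moreover have "0 \<le> s' t" if "t \<in> {a..b}" for t
    using p_interface_nonpos[of t] stefan[of t] \<beta> that \<open>0 \<le> a\<close> by (simp add: zero_le_divide_iff)
  ultimately have "0 \<le> s b - s a" by (rule has_integral_nonneg)
  then show ?thesis by simp
qed

lemma integral_u_nonneg: "0 \<le> integral {0..s t} (\<lambda>x. u x t)" if "0 \<le> t"
  by (rule integral_nonneg)
    (use u_nonneg[OF that] that in \<open>auto intro!: integrable_continuous_interval slice_cont[OF u_cont]\<close>)

text \<open>The energy never changes sign and its sensible part is nonnegative, so the negative sign
  must come from \<open>s t - sr\<close>.\<close>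

lemma s_less: "s t < sr" if t: "0 \<le> t"
proof -
  have "energy t < 0" using flux[OF t] flux_eq[OF t] influx_pos[of t] c by (metis neg_less_0_iff_less zero_less_mult_pos mult_minus_right neg_0_less_iff_less)
  moreover have "0 \<le> 1 / \<alpha> * integral {0..s t} (\<lambda>x. u x t)" using \<alpha> integral_u_nonneg[OF t] by simp
  ultimately have "1 / \<beta> * (s t - sr) < 0" by (simp add: energy_def)
  then show ?thesis using \<beta> by (simp add: divide_less_0_iff)
qed

section \<open>Squared norms and the temperature estimate\<close>

definition L2_sq :: "real \<Rightarrow> real" where "L2_sq t = integral {0..s t} (\<lambda>x. (u x t)\<^sup>2)"
definition grad_sq :: "real \<Rightarrow> real" where "grad_sq t = integral {0..s t} (\<lambda>x. (p x t)\<^sup>2)"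

lemma square_cont:
  fixes f :: "real \<Rightarrow> real \<Rightarrow> real"
  assumes "continuous_on (closed_liquid s) (\<lambda>(x, t). f x t)"
  shows "continuous_on (closed_liquid s) (\<lambda>(x, t). (f x t)\<^sup>2)"
  using continuous_on_power[OF assms, of 2] by (simp add: case_prod_unfold)

lemma L2_sq_cont: "continuous_on {0..} L2_sq" and grad_sq_cont: "continuous_on {0..} grad_sq"
  unfolding L2_sq_def grad_sq_def by (intro integral_cont square_cont u_cont p_cont)+

text \<open>The test function \<open>u\<close> varies in time, so \<open>test_balance\<close> does
  not cover this case and \<open>moving_domain_balance\<close> is applied to
  \<open>u\<^sup>2 / 2\<close>. All interface terms contain \<open>u (s t) t\<close> and
  vanish.\<close>

lemma L2_balance:
  assumes ab: "0 \<le> a" "a \<le> b"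
  shows "((\<lambda>t. \<alpha> * (influx t * u 0 t - grad_sq t)) has_integral L2_sq b / 2 - L2_sq a / 2) {a..b}"
proof -
  let ?D = "{(x, t). t \<in> {a..b} \<and> 0 \<le> x \<and> x \<le> s t}" and ?Q = "{(x, t). t \<in> {a<..<b} \<and> 0 < x \<and> x < s t}"
  have sub: "?D \<subseteq> closed_liquid s" "?Q \<subseteq> ?D" "?Q \<subseteq> open_liquid s"
    using ab by (auto simp: closed_liquid_def open_liquid_def)
  have c1: "continuous_on ?D (\<lambda>z. u (fst z) (snd z))" and c2: "continuous_on ?D (\<lambda>z. p (fst z) (snd z))"
    using continuous_on_subset[OF u_cont sub(1)] continuous_on_subset[OF p_cont sub(1)] by (simp_all add: case_prod_unfold)
  note c1' = continuous_on_subset[OF c1 sub(2)] and c2' = continuous_on_subset[OF c2 sub(2)]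
  have c3: "continuous_on ?Q (\<lambda>z. ut (fst z) (snd z))"
    using continuous_on_subset[OF ut_cont sub(3)] by (simp add: case_prod_unfold)
  have "((\<lambda>t. s' t * ((u (s t) t)\<^sup>2 / 2) + \<alpha> * (u (s t) t * p (s t) t) - \<alpha> * (u 0 t * p 0 t)
      - integral {0..s t} (\<lambda>x. \<alpha> * (p x t)\<^sup>2)) has_integral
      integral {0..s b} (\<lambda>x. (u x b)\<^sup>2 / 2) - integral {0..s a} (\<lambda>x. (u x a)\<^sup>2 / 2)) {a..b}"
  proof (rule moving_domain_balance[where w="\<lambda>x t. (u x t)\<^sup>2 / 2" and G="\<lambda>x t. \<alpha> * (u x t * p x t)" and
        R="\<lambda>x t. \<alpha> * (p x t)\<^sup>2" and wx="\<lambda>x t. u x t * p x t" and wt="\<lambda>x t. u x t * ut x t"])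
    have "continuous_on ?D (\<lambda>z. (u (fst z) (snd z))\<^sup>2 / 2)" "continuous_on ?D (\<lambda>z. \<alpha> * (u (fst z) (snd z) * p (fst z) (snd z)))"
      "continuous_on ?D (\<lambda>z. \<alpha> * (p (fst z) (snd z))\<^sup>2)"
      by (intro continuous_on_mult continuous_on_divide continuous_on_power continuous_on_const c1 c2; simp)+
    then show "continuous_on ?D (\<lambda>(x, t). (u x t)\<^sup>2 / 2)" "continuous_on ?D (\<lambda>(x, t). \<alpha> * (u x t * p x t))"
      "continuous_on ?D (\<lambda>(x, t). \<alpha> * (p x t)\<^sup>2)"
      by (simp_all add: case_prod_unfold)
    have "continuous_on ?Q (\<lambda>z. u (fst z) (snd z) * p (fst z) (snd z))" "continuous_on ?Q (\<lambda>z. u (fst z) (snd z) * ut (fst z) (snd z))"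
      by (intro continuous_on_mult c1' c2' c3)+
    then show "continuous_on ?Q (\<lambda>(x, t). u x t * p x t)" "continuous_on ?Q (\<lambda>(x, t). u x t * ut x t)"
      by (simp_all add: case_prod_unfold)
    fix x t assume xt: "(x, t) \<in> ?Q"
    have i: "(x, t) \<in> open_liquid s" "0 \<le> t" "0 < x" "x < s t"
      using xt ab by (auto simp: open_liquid_def)
    note d = u_DERIV[OF i(2-4)]
    show "((\<lambda>y. (u y t)\<^sup>2 / 2) has_real_derivative u x t * p x t) (at x)"
      using DERIV_cdivide[OF DERIV_mult[OF d d], of 2] by (simp add: power2_eq_square mult.commute)
    show "((\<lambda>\<tau>. (u x \<tau>)\<^sup>2 / 2) has_real_derivative u x t * ut x t) (at t)"
      using DERIV_cdivide[OF DERIV_mult[OF u_t[OF i(1)] u_t[OF i(1)]], of 2] by (simp add: power2_eq_square mult.commute)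
    show "((\<lambda>y. \<alpha> * (u y t * p y t)) has_real_derivative u x t * ut x t + \<alpha> * (p x t)\<^sup>2) (at x)"
      by (rule DERIV_cong[OF DERIV_cmult[OF DERIV_mult[OF d heat[OF i(1)]]]])
        (use \<alpha> in \<open>simp add: power2_eq_square distrib_left add.commute mult.commute\<close>)
  qed (use ab s_pos s_conditions[OF ab(1), where b=b] in auto)
  then show ?thesis
    by (rule has_integral_eq_rhs[OF has_integral_eq[rotated]])
      (use ab in \<open>auto simp: melting flux_eq L2_sq_def grad_sq_def algebra_simps\<close>)
qed

text \<open>\<open>u\<close> vanishes at the interface, so it is minus the integral of
  \<open>p\<close> from \<open>x\<close> to \<open>s t\<close>, to which Cauchy-Schwarz applies. At
  \<open>x = 0\<close> this is the trace estimate, and integrated over \<open>x\<close> the Poincare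
  inequality \<open>L2_sq_le\<close>.\<close>

lemma u_sq_le: "(u x t)\<^sup>2 \<le> s t * grad_sq t" if t: "0 \<le> t" and x: "0 \<le> x" "x \<le> s t"
proof -
  have pc: "continuous_on {0..s t} (\<lambda>y. p y t)" by (rule slice_cont[OF p_cont t]) simp
  have pc': "continuous_on {x..s t} (\<lambda>y. p y t)" by (rule continuous_on_subset[OF pc]) (use x in auto)
  have "((\<lambda>y. p y t) has_integral u (s t) t - u x t) {x..s t}"
  proof (rule fundamental_theorem_of_calculus_interior[OF x(2)])
    show "continuous_on {x..s t} (\<lambda>y. u y t)"
      by (rule continuous_on_subset[OF slice_cont[OF u_cont t order_refl]]) (use x in auto)
    show "((\<lambda>y. u y t) has_vector_derivative p y t) (at y)" if "y \<in> {x<..<s t}" for y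
      using u_DERIV[OF t, of y] that x by (auto simp: has_real_derivative_iff_has_vector_derivative)
  qed
  then have "(u x t)\<^sup>2 = (integral {x..s t} (\<lambda>y. p y t))\<^sup>2" by (simp add: melting[OF t] integral_unique)
  also have "\<dots> \<le> (s t - x) * integral {x..s t} (\<lambda>y. (p y t)\<^sup>2)"
    using x(2) pc' by (rule integral_square_le)
  also have "\<dots> \<le> (s t - x) * grad_sq t"
    unfolding grad_sq_def using x
    by (intro mult_left_mono integral_subset_le integrable_continuous_interval continuous_intros pc pc') auto
  also have "\<dots> \<le> s t * grad_sq t"
    using x by (intro mult_right_mono) (auto simp: grad_sq_def intro!: integral_nonneg integrable_continuous_interval continuous_intros pc)
  finally show ?thesis .
qed

lemma L2_sq_le: "L2_sq t \<le> (s t)\<^sup>2 * grad_sq t" if t: "0 \<le> t"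
proof -
  have "L2_sq t \<le> integral {0..s t} (\<lambda>_. s t * grad_sq t)"
    unfolding L2_sq_def using u_sq_le[OF t] t
    by (intro integral_le integrable_continuous_interval continuous_intros slice_cont[OF u_cont]) auto
  then show ?thesis using s_pos[OF t] by (simp add: power2_eq_square algebra_simps)
qed

lemma L2_sq_nonneg: "0 \<le> L2_sq t" and grad_sq_nonneg: "0 \<le> grad_sq t" if t: "0 \<le> t"
  unfolding L2_sq_def grad_sq_def using t
  by (intro integral_nonneg integrable_continuous_interval continuous_intros slice_cont[OF u_cont] slice_cont[OF p_cont]; simp)+

end

subsection \<open>Exponential decay\<close>

text \<open>The first summand keeps the Lyapunov function above the state, the second absorbs the remainder of Young's
  inequality for \<open>(c + \<alpha>) influx u(0, t) \<le> \<alpha>/2 \<parallel>u\<^sub>x\<parallel>\<^sup>2 + \<dots>\<close>.\<close>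

definition flux_weight :: "real \<Rightarrow> real \<Rightarrow> real \<Rightarrow> real" where
  "flux_weight \<alpha> c sr = 2 * sr + (c + \<alpha>)\<^sup>2 * sr / (2 * \<alpha> * c)"

text \<open>The two entries compare, coefficient by coefficient, the dissipation
  \<open>\<alpha> / 2 * grad_sq + c * C * influx\<^sup>2\<close> with the upper bound
  \<open>(sr\<^sup>2 / 2 + 3 / 4) * grad_sq + (C + sr) * influx\<^sup>2\<close> of the Lyapunov
  function, where \<open>C\<close> is the flux weight.\<close>

definition decay_rate :: "real \<Rightarrow> real \<Rightarrow> real \<Rightarrow> real" where
  "decay_rate \<alpha> c sr = min (\<alpha> / (sr\<^sup>2 + 3 / 2)) (c * flux_weight \<alpha> c sr / (flux_weight \<alpha> c sr + sr))"

text \<open>The product of the constants in \<open>state_le_lyapunov\<close> and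
  \<open>lyapunov_0_le\<close>.\<close>

definition overshoot :: "real \<Rightarrow> real \<Rightarrow> real \<Rightarrow> real \<Rightarrow> real" where
  "overshoot \<alpha> \<beta> c sr = (6 + 4 * (\<beta> / \<alpha>)\<^sup>2 * sr + 2 * (\<beta> / c)\<^sup>2 / sr) *
     (1 + (flux_weight \<alpha> c sr + sr) * c\<^sup>2 * (2 * sr / \<alpha>\<^sup>2 + 2 / \<beta>\<^sup>2))"

lemma flux_weight_pos: "0 < \<alpha> \<Longrightarrow> 0 < c \<Longrightarrow> 0 < sr \<Longrightarrow> 0 < flux_weight \<alpha> c sr"
  unfolding flux_weight_def by (intro add_pos_nonneg) auto

lemma decay_rate_pos: "0 < \<alpha> \<Longrightarrow> 0 < c \<Longrightarrow> 0 < sr \<Longrightarrow> 0 < decay_rate \<alpha> c sr"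
  using flux_weight_pos[of \<alpha> c sr] by (auto simp: decay_rate_def intro!: divide_pos_pos add_nonneg_pos)

lemma overshoot_pos: "0 < \<alpha> \<Longrightarrow> 0 < \<beta> \<Longrightarrow> 0 < c \<Longrightarrow> 0 < sr \<Longrightarrow> 0 < overshoot \<alpha> \<beta> c sr"
  using flux_weight_pos[of \<alpha> c sr] unfolding overshoot_def
  by (intro mult_pos_pos add_pos_nonneg mult_nonneg_nonneg add_nonneg_nonneg divide_nonneg_nonneg) auto

section \<open>Estimate of the gradient\<close>

context stefan_loop begin

text \<open>The inner product of the gradients at two times, each extended by zero beyond its
  interface. The extended gradients may jump there, yet the kernel is jointly continuous.\<close>

definition grad_kernel :: "real \<Rightarrow> real \<Rightarrow> real" where
  "grad_kernel \<tau> \<sigma> = integral {0..min (s \<tau>) (s \<sigma>)} (\<lambda>x. p x \<tau> * p x \<sigma>)"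

lemma grad_kernel_diag: "grad_kernel t t = grad_sq t" by (simp add: grad_kernel_def grad_sq_def power2_eq_square)

lemma grad_kernel_sym: "grad_kernel \<tau> \<sigma> = grad_kernel \<sigma> \<tau>" by (simp add: grad_kernel_def min.commute mult.commute)

lemma grad_kernel_cont: "continuous_on ({0..} \<times> {0..}) (\<lambda>z. grad_kernel (fst z) (snd z))"
  unfolding grad_kernel_def
proof (rule continuous_on_moving_integral)
  show "continuous_on ({0..} \<times> {0..}) (\<lambda>z. min (s (fst z)) (s (snd z)))"
    by (intro continuous_on_min continuous_on_compose2[OF s_cont] continuous_intros) auto
  show "continuous_on {(x, z). z \<in> {0..} \<times> {0..} \<and> 0 \<le> x \<and> x \<le> min (s (fst z)) (s (snd z))}
    (\<lambda>(x, z). p x (fst z) * p x (snd z))"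
    unfolding case_prod_unfold
    by (intro continuous_on_mult continuous_on_along[OF p_cont]) (auto intro!: continuous_intros)
qed (use s_pos in auto)

lemma u_left_cont: "continuous_on {0..} (\<lambda>t. u 0 t)"
  by (rule interface_cont(2)[OF u_cont])

text \<open>Test the heat equation on \<open>{t..t + h}\<close> with \<open>u(\<cdot>, t + h)\<close> on \<open>{0..s \<tau>}\<close> and with \<open>u(\<cdot>, t)\<close> on the fixed
  interval \<open>{0..s t}\<close>. The difference of the two left-hand sides is the squared norm of the increment of \<open>u\<close>,
  extended by zero, and the interface contributes a term of the right sign, since \<open>s\<close> is nondecreasing.\<close>

lemma grad_kernel_increment_le:
  assumes t: "0 \<le> t" and h: "0 < h"
  shows "integral {t..t + h} (\<lambda>\<tau>. grad_kernel \<tau> (t + h) - grad_kernel \<tau> t) \<le> integral {t..t + h} influx * (u 0 (t + h) - u 0 t)"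
proof -
  define b where "b = t + h"
  have b: "t \<le> b" "0 \<le> b" using t h by (auto simp: b_def)
  have sb: "s t \<le> s \<tau>" "s \<tau> \<le> s b" if "\<tau> \<in> {t..b}" for \<tau>
    using that t by (auto intro: s_mono)
  have ucb: "continuous_on {0..s b} (\<lambda>x. u x b)" "continuous_on {0..s t} (\<lambda>x. u x b)"
    "continuous_on {0..s t} (\<lambda>x. u x t)"
    using slice_cont[OF u_cont b(2)] slice_cont[OF u_cont t] sb[of t] b by auto
  have grad_kernel_int: "(\<lambda>\<tau>. grad_kernel \<tau> \<sigma>) integrable_on {t..b}" if "0 \<le> \<sigma>" for \<sigma>
  proof (rule integrable_continuous_interval)
    have "continuous_on {t..b} (\<lambda>\<tau>. grad_kernel (fst (\<tau>, \<sigma>)) (snd (\<tau>, \<sigma>)))"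
      by (rule continuous_on_compose2[OF grad_kernel_cont]) (use that t in \<open>auto intro!: continuous_intros\<close>)
    then show "continuous_on {t..b} (\<lambda>\<tau>. grad_kernel \<tau> \<sigma>)" by simp
  qed
  have influx_int: "influx integrable_on {t..b}"
    unfolding influx_def[abs_def] by (intro integrable_continuous_interval continuous_intros)
  have I2: "((\<lambda>\<tau>. s' \<tau> * (u (s \<tau>) \<tau> * u (s \<tau>) b) + \<alpha> * p (s \<tau>) \<tau> * u (s \<tau>) b - \<alpha> * p 0 \<tau> * u 0 b
      - integral {0..s \<tau>} (\<lambda>x. \<alpha> * (p x \<tau> * p x b))) has_integral
      integral {0..s b} (\<lambda>x. u x b * u x b) - integral {0..s t} (\<lambda>x. u x t * u x b)) {t..b}"
    by (rule test_balance[where L="s b"])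
      (use t b sb s_pos s_conditions[OF t, where b=b] slice_cont[OF p_cont b(2)] ucb u_DERIV in auto)
  \<comment> \<open>The interval is frozen at \<open>s t\<close> because the test function
    \<open>u(\<cdot>, t)\<close> lives only there and vanishes at its right end, which removes the
    boundary term.\<close>
  have I1: "((\<lambda>\<tau>. 0 * (u (s t) \<tau> * u (s t) t) + \<alpha> * p (s t) \<tau> * u (s t) t - \<alpha> * p 0 \<tau> * u 0 t
      - integral {0..s t} (\<lambda>x. \<alpha> * (p x \<tau> * p x t))) has_integral
      integral {0..s t} (\<lambda>x. u x b * u x t) - integral {0..s t} (\<lambda>x. u x t * u x t)) {t..b}"
    by (rule test_balance[where L="s t"])
      (use t b sb s_pos slice_cont[OF p_cont t] ucb u_DERIV in auto)
  let ?J = "\<lambda>\<tau>. \<alpha> * (influx \<tau> * (u 0 b - u 0 t) - (grad_kernel \<tau> b - grad_kernel \<tau> t))"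
  have "(?J has_integral \<alpha> * (integral {t..b} influx * (u 0 b - u 0 t) - (integral {t..b} (\<lambda>\<tau>. grad_kernel \<tau> b) - integral {t..b} (\<lambda>\<tau>. grad_kernel \<tau> t)))) {t..b}"
    by (intro has_integral_mult_right has_integral_diff has_integral_mult_left integrable_integral grad_kernel_int influx_int b t)
  with has_integral_diff[OF I2 I1]
  have "integral {0..s b} (\<lambda>x. u x b * u x b) - integral {0..s t} (\<lambda>x. u x t * u x b)
      - (integral {0..s t} (\<lambda>x. u x b * u x t) - integral {0..s t} (\<lambda>x. u x t * u x t))
    \<le> \<alpha> * (integral {t..b} influx * (u 0 b - u 0 t) - (integral {t..b} (\<lambda>\<tau>. grad_kernel \<tau> b) - integral {t..b} (\<lambda>\<tau>. grad_kernel \<tau> t)))"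
  proof (rule has_integral_le)
    fix \<tau> assume \<tau>: "\<tau> \<in> {t..b}"
    then have \<tau>0: "0 \<le> \<tau>" using t by simp
    have "p (s \<tau>) \<tau> * u (s \<tau>) b \<le> 0"
      using p_interface_nonpos[OF \<tau>0] u_nonneg[OF b(2), of "s \<tau>"] s_pos[OF \<tau>0] sb[OF \<tau>]
      by (intro mult_nonpos_nonneg) auto
    then have "\<alpha> * p (s \<tau>) \<tau> * u (s \<tau>) b \<le> 0" using \<alpha> by (simp add: mult.assoc mult_le_0_iff)
    moreover have "integral {0..s \<tau>} (\<lambda>x. \<alpha> * (p x \<tau> * p x b)) = \<alpha> * grad_kernel \<tau> b"
      "integral {0..s t} (\<lambda>x. \<alpha> * (p x \<tau> * p x t)) = \<alpha> * grad_kernel \<tau> t"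
      using sb[OF \<tau>] by (simp_all add: grad_kernel_def min_def)
    ultimately show "(s' \<tau> * (u (s \<tau>) \<tau> * u (s \<tau>) b) + \<alpha> * p (s \<tau>) \<tau> * u (s \<tau>) b - \<alpha> * p 0 \<tau> * u 0 b
        - integral {0..s \<tau>} (\<lambda>x. \<alpha> * (p x \<tau> * p x b))) -
        (0 * (u (s t) \<tau> * u (s t) t) + \<alpha> * p (s t) \<tau> * u (s t) t - \<alpha> * p 0 \<tau> * u 0 t
        - integral {0..s t} (\<lambda>x. \<alpha> * (p x \<tau> * p x t))) \<le> ?J \<tau>"
      using \<alpha> by (simp add: melting[OF \<tau>0] melting[OF t] flux_eq[OF \<tau>0] algebra_simps)
  qed
  moreover have "0 \<le> integral {0..s b} (\<lambda>x. u x b * u x b) - integral {0..s t} (\<lambda>x. u x t * u x b)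
      - (integral {0..s t} (\<lambda>x. u x b * u x t) - integral {0..s t} (\<lambda>x. u x t * u x t))"
  proof -
    have "((\<lambda>x. (u x b * u x b - u x t * u x b) - (u x b * u x t - u x t * u x t)) has_integral
       (integral {0..s t} (\<lambda>x. u x b * u x b) - integral {0..s t} (\<lambda>x. u x t * u x b))
      - (integral {0..s t} (\<lambda>x. u x b * u x t) - integral {0..s t} (\<lambda>x. u x t * u x t))) {0..s t}"
      by (intro has_integral_diff integrable_integral integrable_continuous_interval continuous_on_mult ucb)
    then have "0 \<le> (integral {0..s t} (\<lambda>x. u x b * u x b) - integral {0..s t} (\<lambda>x. u x t * u x b))
      - (integral {0..s t} (\<lambda>x. u x b * u x t) - integral {0..s t} (\<lambda>x. u x t * u x t))"
    proof (rule has_integral_nonneg)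
      show "0 \<le> (u x b * u x b - u x t * u x b) - (u x b * u x t - u x t * u x t)" for x
        using zero_le_square[of "u x b - u x t"] by (simp add: algebra_simps)
    qed
    moreover have "integral {0..s t} (\<lambda>x. u x b * u x b) \<le> integral {0..s b} (\<lambda>x. u x b * u x b)"
      using sb[of t] b by (intro integral_subset_le integrable_continuous_interval continuous_on_mult ucb) auto
    ultimately show ?thesis by simp
  qed
  ultimately have "0 \<le> integral {t..b} influx * (u 0 b - u 0 t) - (integral {t..b} (\<lambda>\<tau>. grad_kernel \<tau> b) - integral {t..b} (\<lambda>\<tau>. grad_kernel \<tau> t))"
    using \<alpha> by (meson order_trans zero_le_mult_iff not_le)
  moreover have "integral {t..b} (\<lambda>\<tau>. grad_kernel \<tau> b - grad_kernel \<tau> t) = integral {t..b} (\<lambda>\<tau>. grad_kernel \<tau> b) - integral {t..b} (\<lambda>\<tau>. grad_kernel \<tau> t)"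
    by (intro Henstock_Kurzweil_Integration.integral_diff grad_kernel_int b t)
  ultimately show ?thesis by (simp add: b_def)
qed

text \<open>The right-hand side arises because the derivative moved onto \<open>influx\<close> is
  \<open>- c * influx\<close>.\<close>

lemma gradient_balance:
  assumes ab: "0 \<le> a" "a \<le> b"
  shows "(grad_sq b / 2 - influx b * u 0 b) - (grad_sq a / 2 - influx a * u 0 a) \<le> integral {a..b} (\<lambda>t. c * influx t * u 0 t)"
proof -
  \<comment> \<open>Freezing the state at time 0 extends kernel and boundary value continuously to
    negative times, since \<open>kernel_energy_le\<close> works on the whole line.\<close>
  have "(grad_kernel (max 0 b) (max 0 b) / 2 - influx b * u 0 (max 0 b)) - (grad_kernel (max 0 a) (max 0 a) / 2 - influx a * u 0 (max 0 a))
    \<le> - integral {a..b} (\<lambda>t. (- c * influx t) * u 0 (max 0 t))"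
  proof (rule kernel_energy_le[of "\<lambda>x y. grad_kernel (max 0 x) (max 0 y)" "\<lambda>t. u 0 (max 0 t)" influx "\<lambda>t. - c * influx t" a b])
    have "continuous_on UNIV (\<lambda>z. grad_kernel (fst (max 0 (fst z), max 0 (snd z))) (snd (max 0 (fst z), max 0 (snd z :: real))))"
      by (rule continuous_on_compose2[OF grad_kernel_cont]) (auto intro!: continuous_intros continuous_on_max)
    then show "continuous_on UNIV (\<lambda>(x, y). grad_kernel (max 0 x) (max 0 y))" by (simp add: case_prod_unfold)
    show "continuous_on UNIV (\<lambda>t. u 0 (max 0 t))"
      by (rule continuous_on_compose2[OF u_left_cont]) (auto intro!: continuous_intros continuous_on_max)
    show "(influx has_real_derivative - c * influx x) (at x)" for x
      unfolding influx_def[abs_def] by (auto intro!: derivative_eq_intros)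
    show "continuous_on UNIV (\<lambda>t. - c * influx t)"
      unfolding influx_def by (intro continuous_intros)
    fix t h :: real assume t: "a \<le> t" and h: "0 < h"
    have "integral {t..t + h} (\<lambda>\<tau>. grad_kernel (max 0 \<tau>) (max 0 (t + h)) - grad_kernel (max 0 \<tau>) (max 0 t))
       = integral {t..t + h} (\<lambda>\<tau>. grad_kernel \<tau> (t + h) - grad_kernel \<tau> t)"
      using t h ab by (intro integral_cong) (auto simp: max_def)
    with grad_kernel_increment_le[of t h] t h ab
    show "integral {t..t + h} (\<lambda>\<tau>. grad_kernel (max 0 \<tau>) (max 0 (t + h)) - grad_kernel (max 0 \<tau>) (max 0 t))
        \<le> integral {t..t + h} influx * (u 0 (max 0 (t + h)) - u 0 (max 0 t))"
      by (simp add: max_def)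
  qed (use ab grad_kernel_sym in auto)
  moreover have "integral {a..b} (\<lambda>t. (- c * influx t) * u 0 (max 0 t)) = integral {a..b} (\<lambda>t. - (c * influx t * u 0 t))"
    using ab by (intro integral_cong) (auto simp: max_def)
  ultimately show ?thesis using ab by (simp add: grad_kernel_diag max_def)
qed

section \<open>The Lyapunov function\<close>

abbreviation (input) C where "C \<equiv> flux_weight \<alpha> c sr"

text \<open>The bracket is the quantity controlled by \<open>gradient_balance\<close>. It has no
  sign by itself; the weighted square of the influx compensates for that.\<close>

definition lyapunov :: "real \<Rightarrow> real" where
  "lyapunov t = L2_sq t / 2 + (grad_sq t / 2 - influx t * u 0 t) + C * (influx t)\<^sup>2"

lemma sr_pos: "0 < sr"
  using s_pos[of 0] s_less[of 0] by simp

text \<open>Young's inequality combined with the trace estimate \<open>u_sq_le\<close> at the left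
  end and \<open>s t < sr\<close>. The weight \<open>e\<close> stays free because it is chosen
  differently in \<open>lyapunov_lower\<close> and in \<open>dissipation\<close>.\<close>

lemma flux_product_le:
  assumes t: "0 \<le> t" and e: "0 < e"
  shows "influx t * u 0 t \<le> e * grad_sq t + sr / (4 * e) * (influx t)\<^sup>2"
proof -
  have "(u 0 t)\<^sup>2 \<le> s t * grad_sq t" using u_sq_le[OF t, of 0] s_pos[OF t] by simp
  also have "\<dots> \<le> sr * grad_sq t" using s_less[OF t] grad_sq_nonneg[OF t] by (intro mult_right_mono) auto
  finally have v: "e / sr * (u 0 t)\<^sup>2 \<le> e * grad_sq t" using sr_pos e by (simp add: field_simps)
  have "0 \<le> e / sr * (u 0 t - sr / (2 * e) * influx t)\<^sup>2" using sr_pos e by simp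
  also have "\<dots> = e / sr * (u 0 t)\<^sup>2 - influx t * u 0 t + sr / (4 * e) * (influx t)\<^sup>2"
    using sr_pos e by (simp add: power2_eq_square field_simps)
  finally show ?thesis using v by simp
qed

lemma lyapunov_lower: "L2_sq t / 2 + grad_sq t / 4 + sr * (influx t)\<^sup>2 \<le> lyapunov t" if "0 \<le> t"
proof -
  \<comment> \<open>With \<open>e = 1/4\<close>, half of the term \<open>grad_sq t / 2\<close> is
    spent at the price \<open>sr * (influx t)\<^sup>2\<close>, which leaves one of the two multiples
    of \<open>sr\<close> contained in \<open>C\<close>.\<close>
  have "2 * sr * (influx t)\<^sup>2 \<le> C * (influx t)\<^sup>2"
    using \<alpha> c sr_pos by (intro mult_right_mono) (auto simp: flux_weight_def)
  with flux_product_le[OF that, of "1/4"] show ?thesis by (simp add: lyapunov_def)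
qed

lemma lyapunov_upper: "lyapunov t \<le> L2_sq t / 2 + 3 / 4 * grad_sq t + (C + sr) * (influx t)\<^sup>2" if t: "0 \<le> t"
proof -
  have "- (influx t * u 0 t) \<le> 0"
    using influx_pos[of t] u_nonneg[OF t, of 0] s_pos[OF t] by (simp add: mult_nonneg_nonneg)
  moreover have "0 \<le> sr * (influx t)\<^sup>2" "0 \<le> grad_sq t" using sr_pos grad_sq_nonneg[OF t] by auto
  ultimately show ?thesis by (simp add: lyapunov_def algebra_simps)
qed

text \<open>The left side adds the integrands from \<open>L2_balance\<close> and
  \<open>gradient_balance\<close> to the derivative of
  \<open>C * (influx t)\<^sup>2\<close>.\<close>

lemma dissipation:
  assumes t: "0 \<le> t"
  shows "\<alpha> * (influx t * u 0 t - grad_sq t) + c * influx t * u 0 t + C * (- 2 * c * (influx t)\<^sup>2) \<le> - decay_rate \<alpha> c sr * lyapunov t"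
proof -
  have C_pos: "0 < C" using flux_weight_pos[OF \<alpha> c sr_pos] .
  \<comment> \<open>The weight is chosen with \<open>(c + \<alpha>) * e = \<alpha> / 2\<close>, so
    half of the gradient dissipation is spent. The remainder is \<open>c\<close> times the second
    summand of \<open>flux_weight\<close>, which costs one of the two multiples of
    \<open>c * C\<close> available.\<close>
  have "(c + \<alpha>) * (influx t * u 0 t) \<le> (c + \<alpha>) * (\<alpha> / (2 * (c + \<alpha>)) * grad_sq t + sr / (4 * (\<alpha> / (2 * (c + \<alpha>)))) * (influx t)\<^sup>2)"
    using \<alpha> c by (intro mult_left_mono flux_product_le t) auto
  also have "\<dots> = \<alpha> / 2 * grad_sq t + c * ((c + \<alpha>)\<^sup>2 * sr / (2 * \<alpha> * c)) * (influx t)\<^sup>2"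
    using \<alpha> c add_pos_pos[OF c \<alpha>] by (simp add: power2_eq_square divide_simps) (simp add: algebra_simps)
  also have "\<dots> \<le> \<alpha> / 2 * grad_sq t + c * C * (influx t)\<^sup>2"
    using c sr_pos by (intro add_left_mono mult_right_mono mult_left_mono) (auto simp: flux_weight_def)
  finally have 1: "\<alpha> * (influx t * u 0 t - grad_sq t) + c * influx t * u 0 t + C * (- 2 * c * (influx t)\<^sup>2)
      \<le> - (\<alpha> / 2 * grad_sq t + c * C * (influx t)\<^sup>2)"
    by (simp add: algebra_simps)
  have "(s t)\<^sup>2 * grad_sq t \<le> sr\<^sup>2 * grad_sq t"
    using s_less[OF t] s_pos[OF t] grad_sq_nonneg[OF t] by (intro mult_right_mono power_mono) auto
  with L2_sq_le[OF t] lyapunov_upper[OF t] have "lyapunov t \<le> (sr\<^sup>2 / 2 + 3 / 4) * grad_sq t + (C + sr) * (influx t)\<^sup>2"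
    by (simp add: algebra_simps)
  then have "decay_rate \<alpha> c sr * lyapunov t \<le> decay_rate \<alpha> c sr * ((sr\<^sup>2 / 2 + 3 / 4) * grad_sq t + (C + sr) * (influx t)\<^sup>2)"
    using decay_rate_pos[OF \<alpha> c sr_pos] by (intro mult_left_mono) auto
  also have "\<dots> = (decay_rate \<alpha> c sr * (sr\<^sup>2 / 2 + 3 / 4)) * grad_sq t + (decay_rate \<alpha> c sr * (C + sr)) * (influx t)\<^sup>2"
    by (simp add: algebra_simps)
  also have "\<dots> \<le> \<alpha> / 2 * grad_sq t + c * C * (influx t)\<^sup>2"
  proof (intro add_mono mult_right_mono grad_sq_nonneg t)
    have p: "0 < sr\<^sup>2 + 3 / 2" by (intro add_nonneg_pos) auto
    have "decay_rate \<alpha> c sr * (sr\<^sup>2 + 3 / 2) \<le> \<alpha> / (sr\<^sup>2 + 3 / 2) * (sr\<^sup>2 + 3 / 2)"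
      using p by (intro mult_right_mono) (auto simp: decay_rate_def)
    also have "\<dots> = \<alpha>" using p by simp
    finally show "decay_rate \<alpha> c sr * (sr\<^sup>2 / 2 + 3 / 4) \<le> \<alpha> / 2" by (simp add: algebra_simps)
    have "decay_rate \<alpha> c sr * (C + sr) \<le> c * C / (C + sr) * (C + sr)"
      using C_pos sr_pos by (intro mult_right_mono) (auto simp: decay_rate_def)
    then show "decay_rate \<alpha> c sr * (C + sr) \<le> c * C" using C_pos sr_pos by simp
  qed auto
  finally show ?thesis using 1 by linarith
qed

lemma influx_cont: "continuous_on S influx"
  unfolding influx_def[abs_def] by (intro continuous_intros)

lemma lyapunov_cont: "continuous_on {0..} lyapunov"
  unfolding lyapunov_def[abs_def] by (intro continuous_intros L2_sq_cont grad_sq_cont u_left_cont influx_cont) auto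

lemma lyapunov_decay: "lyapunov t \<le> lyapunov 0 * exp (- decay_rate \<alpha> c sr * t)" if t: "0 \<le> t"
proof (rule gronwall_integral[OF decay_rate_pos[OF \<alpha> c sr_pos] lyapunov_cont t])
  fix a b :: real assume ab: "0 \<le> a" "a \<le> b"
  have 1: "((\<lambda>t. - 2 * c * (influx t)\<^sup>2) has_integral (influx b)\<^sup>2 - (influx a)\<^sup>2) {a..b}"
  proof (rule fundamental_theorem_of_calculus[OF ab(2)])
    have "(influx has_real_derivative - c * influx t) (at t within {a..b})" for t
      unfolding influx_def[abs_def] by (auto intro!: derivative_eq_intros)
    from DERIV_mult[OF this this]
    show "((\<lambda>t. (influx t)\<^sup>2) has_vector_derivative - 2 * c * (influx t)\<^sup>2) (at t within {a..b})" for t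
      unfolding has_real_derivative_iff_has_vector_derivative by (simp add: power2_eq_square algebra_simps)
  qed
  have "(\<lambda>t. c * influx t * u 0 t) integrable_on {a..b}"
    using ab by (intro integrable_continuous_interval continuous_on_mult continuous_on_const influx_cont continuous_on_subset[OF u_left_cont]) auto
  then have 2: "((\<lambda>t. c * influx t * u 0 t) has_integral integral {a..b} (\<lambda>t. c * influx t * u 0 t)) {a..b}"
    by (rule integrable_integral)
  have "lyapunov integrable_on {a..b}"
    using ab by (intro integrable_continuous_interval continuous_on_subset[OF lyapunov_cont]) auto
  then have 3: "((\<lambda>t. - decay_rate \<alpha> c sr * lyapunov t) has_integral - decay_rate \<alpha> c sr * integral {a..b} lyapunov) {a..b}"
    by (intro has_integral_mult_right integrable_integral)
  have "(L2_sq b / 2 - L2_sq a / 2) + integral {a..b} (\<lambda>t. c * influx t * u 0 t) + C * ((influx b)\<^sup>2 - (influx a)\<^sup>2)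
      \<le> - decay_rate \<alpha> c sr * integral {a..b} lyapunov"
    by (rule has_integral_le[OF has_integral_add[OF has_integral_add[OF L2_balance[OF ab] 2] has_integral_mult_right[OF 1]] 3])
      (use dissipation ab in auto)
  with gradient_balance[OF ab] show "lyapunov b - lyapunov a \<le> - decay_rate \<alpha> c sr * integral {a..b} lyapunov"
    by (simp add: lyapunov_def algebra_simps)
qed

lemma integral_u_square_le: "(integral {0..s t} (\<lambda>x. u x t))\<^sup>2 \<le> sr * L2_sq t" if t: "0 \<le> t"
proof -
  have "(integral {0..s t} (\<lambda>x. u x t))\<^sup>2 \<le> (s t - 0) * integral {0..s t} (\<lambda>x. (u x t)\<^sup>2)"
    by (rule integral_square_le) (use s_pos[OF t] slice_cont[OF u_cont t] in auto)
  also have "\<dots> \<le> sr * L2_sq t"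
    using s_less[OF t] L2_sq_nonneg[OF t] by (auto simp: L2_sq_def intro!: mult_right_mono)
  finally show ?thesis .
qed

lemma sum_square_le: "(x + y)\<^sup>2 \<le> 2 * x\<^sup>2 + 2 * y\<^sup>2" for x y :: real
  using zero_le_power2[of "x - y"] by (simp add: power2_eq_square algebra_simps)

text \<open>The distance to the setpoint does not occur in \<open>lyapunov\<close>; it is recovered
  from the definition of the energy, which expresses \<open>s t - sr\<close> by the influx and the
  integral of \<open>u\<close>. The 6 is 2 + 4, the reciprocals of the weights 1/2 and 1/4 in
  \<open>lyapunov_lower\<close>.\<close>

lemma state_le_lyapunov:
  assumes t: "0 \<le> t"
  shows "L2_sq t + grad_sq t + (s t - sr)\<^sup>2 \<le> (6 + 4 * (\<beta> / \<alpha>)\<^sup>2 * sr + 2 * (\<beta> / c)\<^sup>2 / sr) * lyapunov t"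
proof -
  define U where "U = integral {0..s t} (\<lambda>x. u x t)"
  have energy: "energy t = - influx t / c" using flux[OF t] flux_eq[OF t] c by (simp add: field_simps)
  have "s t - sr = - (\<beta> / c * influx t) + - (\<beta> / \<alpha> * U)"
    using energy \<beta> \<alpha> c by (simp add: energy_def U_def field_simps)
  then have "(s t - sr)\<^sup>2 \<le> 2 * (\<beta> / c * influx t)\<^sup>2 + 2 * (\<beta> / \<alpha> * U)\<^sup>2"
    using sum_square_le[of "- (\<beta> / c * influx t)" "- (\<beta> / \<alpha> * U)"] by simp
  also have "\<dots> = 2 * (\<beta> / c)\<^sup>2 * (influx t)\<^sup>2 + 2 * (\<beta> / \<alpha>)\<^sup>2 * U\<^sup>2"
    by (simp only: power_mult_distrib mult.assoc)
  also have "\<dots> \<le> 2 * (\<beta> / c)\<^sup>2 * (lyapunov t / sr) + 2 * (\<beta> / \<alpha>)\<^sup>2 * (sr * (2 * lyapunov t))"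
  proof (intro add_mono mult_left_mono)
    have nk: "0 \<le> L2_sq t" "0 \<le> grad_sq t" "0 \<le> sr * (influx t)\<^sup>2" using L2_sq_nonneg[OF t] grad_sq_nonneg[OF t] sr_pos by auto
    then show "(influx t)\<^sup>2 \<le> lyapunov t / sr" using lyapunov_lower[OF t] sr_pos by (simp add: field_simps)
    have "L2_sq t \<le> 2 * lyapunov t" using lyapunov_lower[OF t] nk by simp
    then show "U\<^sup>2 \<le> sr * (2 * lyapunov t)"
      using integral_u_square_le[OF t] sr_pos by (auto simp: U_def intro: order_trans mult_left_mono)
  qed auto
  finally have X: "(s t - sr)\<^sup>2 \<le> 2 * (\<beta> / c)\<^sup>2 * (lyapunov t / sr) + 2 * (\<beta> / \<alpha>)\<^sup>2 * (sr * (2 * lyapunov t))" .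
  have "0 \<le> sr * (influx t)\<^sup>2" using sr_pos by simp
  then have "L2_sq t + grad_sq t \<le> 2 * lyapunov t + 4 * lyapunov t"
    using lyapunov_lower[OF t] L2_sq_nonneg[OF t] grad_sq_nonneg[OF t] by linarith
  with X have "L2_sq t + grad_sq t + (s t - sr)\<^sup>2 \<le> 6 * lyapunov t + (2 * (\<beta> / c)\<^sup>2 * (lyapunov t / sr) + 2 * (\<beta> / \<alpha>)\<^sup>2 * (sr * (2 * lyapunov t)))"
    by linarith
  also have "\<dots> = (6 + 4 * (\<beta> / \<alpha>)\<^sup>2 * sr + 2 * (\<beta> / c)\<^sup>2 / sr) * lyapunov t"
    by (simp add: algebra_simps)
  finally show ?thesis .
qed

text \<open>After \<open>lyapunov_upper\<close> only the initial influx is foreign to the norm. It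
  is \<open>- c * energy 0\<close>, hence linear in the integral of \<open>u\<close> and in
  \<open>s 0 - sr\<close>, both of which the norm controls.\<close>

lemma lyapunov_0_le: "lyapunov 0 \<le> (1 + (C + sr) * c\<^sup>2 * (2 * sr / \<alpha>\<^sup>2 + 2 / \<beta>\<^sup>2)) * (L2_sq 0 + grad_sq 0 + (s 0 - sr)\<^sup>2)"
proof -
  define U where "U = integral {0..s 0} (\<lambda>x. u x 0)"
  define X where "X = s 0 - sr"
  have nk: "0 \<le> L2_sq 0" "0 \<le> grad_sq 0" using L2_sq_nonneg[of 0] grad_sq_nonneg[of 0] by auto
  have C_pos: "0 < C" using flux_weight_pos[OF \<alpha> c sr_pos] .
  have "(energy 0)\<^sup>2 \<le> 2 * (1 / \<alpha> * U)\<^sup>2 + 2 * (1 / \<beta> * X)\<^sup>2"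
    unfolding energy_def U_def X_def by (rule sum_square_le)
  also have "\<dots> = 2 / \<alpha>\<^sup>2 * U\<^sup>2 + 2 / \<beta>\<^sup>2 * X\<^sup>2" by (simp add: power_mult_distrib power_divide)
  also have "\<dots> \<le> 2 / \<alpha>\<^sup>2 * (sr * L2_sq 0) + 2 / \<beta>\<^sup>2 * X\<^sup>2"
    using integral_u_square_le[of 0] by (intro add_mono mult_left_mono) (auto simp: U_def)
  also have "\<dots> = 2 * sr / \<alpha>\<^sup>2 * L2_sq 0 + 2 / \<beta>\<^sup>2 * X\<^sup>2" by simp
  also have "\<dots> \<le> 2 * sr / \<alpha>\<^sup>2 * (L2_sq 0 + grad_sq 0 + X\<^sup>2) + 2 / \<beta>\<^sup>2 * (L2_sq 0 + grad_sq 0 + X\<^sup>2)"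
    using nk sr_pos by (intro add_mono mult_left_mono) auto
  finally have "(energy 0)\<^sup>2 \<le> (2 * sr / \<alpha>\<^sup>2 + 2 / \<beta>\<^sup>2) * (L2_sq 0 + grad_sq 0 + X\<^sup>2)" by (simp only: distrib_right)
  then have "((C + sr) * c\<^sup>2) * (energy 0)\<^sup>2 \<le> ((C + sr) * c\<^sup>2) * ((2 * sr / \<alpha>\<^sup>2 + 2 / \<beta>\<^sup>2) * (L2_sq 0 + grad_sq 0 + X\<^sup>2))"
    using C_pos sr_pos by (intro mult_left_mono) auto
  moreover have "(influx 0)\<^sup>2 = c\<^sup>2 * (energy 0)\<^sup>2" by (simp add: influx_def power_mult_distrib)
  moreover have "L2_sq 0 / 2 + 3 / 4 * grad_sq 0 \<le> L2_sq 0 + grad_sq 0 + X\<^sup>2" using nk zero_le_power2[of X] by linarith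
  ultimately have "lyapunov 0 \<le> (L2_sq 0 + grad_sq 0 + X\<^sup>2) + ((C + sr) * c\<^sup>2) * ((2 * sr / \<alpha>\<^sup>2 + 2 / \<beta>\<^sup>2) * (L2_sq 0 + grad_sq 0 + X\<^sup>2))"
    using lyapunov_upper[of 0] by (simp add: mult.assoc)
  then show ?thesis unfolding X_def by (simp only: distrib_right mult.assoc mult_1)
qed

theorem exponential_decay:
  assumes t: "0 \<le> t"
  shows "L2_sq t + grad_sq t + (s t - sr)\<^sup>2
    \<le> overshoot \<alpha> \<beta> c sr * (L2_sq 0 + grad_sq 0 + (s 0 - sr)\<^sup>2) * exp (- decay_rate \<alpha> c sr * t)"
proof -
  define M where "M = 6 + 4 * (\<beta> / \<alpha>)\<^sup>2 * sr + 2 * (\<beta> / c)\<^sup>2 / sr"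
  have M: "0 \<le> M" unfolding M_def using sr_pos by (intro add_nonneg_nonneg) auto
  have "L2_sq t + grad_sq t + (s t - sr)\<^sup>2 \<le> M * lyapunov t" unfolding M_def by (rule state_le_lyapunov[OF t])
  also have "\<dots> \<le> M * (lyapunov 0 * exp (- decay_rate \<alpha> c sr * t))"
    by (rule mult_left_mono[OF lyapunov_decay[OF t] M])
  also have "\<dots> \<le> M * (((1 + (C + sr) * c\<^sup>2 * (2 * sr / \<alpha>\<^sup>2 + 2 / \<beta>\<^sup>2)) * (L2_sq 0 + grad_sq 0 + (s 0 - sr)\<^sup>2))
      * exp (- decay_rate \<alpha> c sr * t))"
    by (rule mult_left_mono[OF mult_right_mono[OF lyapunov_0_le] M]) simp
  also have "\<dots> = overshoot \<alpha> \<beta> c sr * (L2_sq 0 + grad_sq 0 + (s 0 - sr)\<^sup>2) * exp (- decay_rate \<alpha> c sr * t)"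
    by (simp only: overshoot_def M_def mult.assoc)
  finally show ?thesis .
qed

end

section \<open>From classical solutions to the locale, and uniform constants\<close>

text \<open>\<open>T0\<close> and the solution at time 0 are only known to agree on
  \<open>{0..s0}\<close> and may differ as total functions.\<close>

lemma dx_cong:
  assumes "\<And>y. y \<in> {0..l} \<Longrightarrow> f y = g y" "x \<in> {0..l}"
  shows "dx l f x = dx l g x"
proof -
  have "(f has_vector_derivative d) (at x within {0..l}) \<longleftrightarrow> (g has_vector_derivative d) (at x within {0..l})" for d
    using assms by (metis has_vector_derivative_transform)
  then show ?thesis by (simp add: dx_def vector_derivative_def)
qed

lemma stefan_loop_of_solution:
  assumes pos: "0 < k" "0 < \<alpha>" "0 < \<beta>" "0 < c"
    and init: "\<And>x. x \<in> {0..s0} \<Longrightarrow> 0 \<le> T0 x - Tm \<and> T0 x - Tm \<le> H * (s0 - x)"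
    and setpoint: "1 / \<alpha> * integral {0..s0} (\<lambda>x. T0 x - Tm) + 1 / \<beta> * (s0 - sr) < 0"
    and sol: "closed_loop_solution c k \<alpha> \<beta> Tm sr T0 s0 T s"
  shows "\<exists>s' Tt. stefan_loop \<alpha> \<beta> c sr s s' (\<lambda>x t. T x t - Tm) (\<lambda>x t. dx (s t) (\<lambda>y. T y t) x) Tt"
proof -
  note conj1 = sol[unfolded closed_loop_solution_def]
  note conj2 = conj1[THEN conjunct2] note conj3 = conj2[THEN conjunct2] note conj4 = conj3[THEN conjunct2]
  note conj5 = conj4[THEN conjunct2] note conj6 = conj5[THEN conjunct2] note conj7 = conj6[THEN conjunct2]
  note conj8 = conj7[THEN conjunct2] note conj9 = conj8[THEN conjunct2]
  note s_pos = conj1[THEN conjunct1, rule_format] and T_cont = conj3[THEN conjunct1]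
    and T_diff = conj4[THEN conjunct1, THEN bspec] and dx_cont = conj5[THEN conjunct1]
    and flux = conj7[THEN conjunct1, rule_format] and melting = conj8[THEN conjunct1, rule_format]
    and T_0 = conj9[THEN conjunct1, rule_format] and s_0 = conj9[THEN conjunct2]
  obtain s' where s': "continuous_on {0..} s' \<and> (\<forall>t\<ge>0. (s has_real_derivative s' t) (at t within {0..})) \<and>
      (\<forall>t>0. s' t = - \<beta> * dx (s t) (\<lambda>y. T y t) (s t))"
    using conj2[THEN conjunct1] by (elim exE)
  obtain Tt Txx where Tt: "continuous_on (open_liquid s) (\<lambda>(x, t). Tt x t) \<and>
      continuous_on (open_liquid s) (\<lambda>(x, t). Txx x t) \<and>
      (\<forall>(x, t)\<in>open_liquid s. ((\<lambda>\<tau>. T x \<tau>) has_real_derivative Tt x t) (at t) \<and>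
         ((\<lambda>y. dx (s t) (\<lambda>z. T z t) y) has_real_derivative Txx x t) (at x) \<and> Tt x t = \<alpha> * Txx x t)"
    using conj6[THEN conjunct1] by (elim exE)
  have Tt': "((\<lambda>\<tau>. T x \<tau>) has_real_derivative Tt x t) (at t) \<and>
      ((\<lambda>y. dx (s t) (\<lambda>z. T z t) y) has_real_derivative Txx x t) (at x) \<and> Tt x t = \<alpha> * Txx x t"
    if "(x, t) \<in> open_liquid s" for x t
    using bspec[OF Tt[THEN conjunct2, THEN conjunct2] that] unfolding prod.case .
  have "stefan_loop \<alpha> \<beta> c sr s s' (\<lambda>x t. T x t - Tm) (\<lambda>x t. dx (s t) (\<lambda>y. T y t) x) Tt"
  proof
    show "continuous_on {0..} s'" "\<And>t. 0 \<le> t \<Longrightarrow> (s has_real_derivative s' t) (at t within {0..})"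
      "\<And>t. 0 < t \<Longrightarrow> s' t = - \<beta> * dx (s t) (\<lambda>y. T y t) (s t)"
      using s' by simp_all
    show "continuous_on (open_liquid s) (\<lambda>(x, t). Tt x t)" by (rule Tt[THEN conjunct1])
    show "continuous_on (closed_liquid s) (\<lambda>(x, t). T x t - Tm)"
      using continuous_on_diff[OF T_cont continuous_on_const[of _ Tm]] by (simp add: case_prod_unfold)
    show "continuous_on (closed_liquid s) (\<lambda>(x, t). dx (s t) (\<lambda>y. T y t) x)" by (rule dx_cont)
    show "((\<lambda>y. T y t - Tm) has_real_derivative dx (s t) (\<lambda>y. T y t) x) (at x within {0..s t})"
      if xt: "(x, t) \<in> closed_liquid s" for x t
    proof -
      have "(\<lambda>y. T y t) differentiable (at x within {0..s t})" using T_diff[OF xt] by simp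
      then have "((\<lambda>y. T y t) has_real_derivative dx (s t) (\<lambda>y. T y t) x) (at x within {0..s t})"
        by (simp add: dx_def has_real_derivative_iff_has_vector_derivative vector_derivative_works)
      from DERIV_diff[OF this DERIV_const] show ?thesis by simp
    qed
    show "((\<lambda>\<tau>. T x \<tau> - Tm) has_real_derivative Tt x t) (at t)" if "(x, t) \<in> open_liquid s" for x t
      using DERIV_diff[OF Tt'[OF that, THEN conjunct1] DERIV_const] by simp
    show "((\<lambda>y. dx (s t) (\<lambda>y. T y t) y) has_real_derivative Tt x t / \<alpha>) (at x)" if "(x, t) \<in> open_liquid s" for x t
      using Tt'[OF that, THEN conjunct2] pos by simp
    show "dx (s t) (\<lambda>y. T y t) 0 = c * (1 / \<alpha> * integral {0..s t} (\<lambda>x. T x t - Tm) + 1 / \<beta> * (s t - sr))"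
      if "0 < t" for t
    proof -
      have "- k * dx (s t) (\<lambda>y. T y t) 0 = control_flux c k \<alpha> \<beta> Tm sr (s t) (\<lambda>y. T y t)" by (rule flux[OF that])
      then have "- k * dx (s t) (\<lambda>y. T y t) 0 =
          - k * (c * (1 / \<alpha> * integral {0..s t} (\<lambda>x. T x t - Tm) + 1 / \<beta> * (s t - sr)))"
        by (simp add: control_flux_def)
      then show ?thesis using pos(1) by (simp only: mult_cancel_left) simp
    qed
    show "T (s t) t - Tm = 0" if "0 \<le> t" for t
    proof (cases "t = 0")
      case True
      \<comment> \<open>At time 0 the melting condition comes from the linear bound on the initial
        profile, which at \<open>x = s0\<close> forces \<open>T0 s0 = Tm\<close>.\<close>
      then show ?thesis using init[of s0] T_0[of s0] s_0 s_pos[of 0] by simp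
    next
      case False
      then show ?thesis using melting[of t] that by simp
    qed
    show "0 \<le> T x 0 - Tm" if "0 \<le> x" "x \<le> s 0" for x
      using init[of x] T_0[of x] s_0 that by simp
    have "integral {0..s 0} (\<lambda>x. T x 0 - Tm) = integral {0..s0} (\<lambda>x. T0 x - Tm)"
      unfolding s_0 by (rule integral_cong) (simp add: T_0)
    then show "1 / \<alpha> * integral {0..s 0} (\<lambda>x. T x 0 - Tm) + 1 / \<beta> * (s 0 - sr) < 0"
      using setpoint by (simp add: s_0)
  qed (use pos s_pos in auto)
  then show ?thesis by blast
qed

theorem theorem1:
  fixes k \<rho> Cp dH Tm \<alpha> \<beta> c sr :: real
  assumes "k > 0" and "\<rho> > 0" and "Cp > 0" and "dH > 0"
    and "\<alpha> = k / (\<rho> * Cp)" and "\<beta> = k / (\<rho> * dH)"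
    and "c > 0"
  shows "\<exists>D>0. \<exists>b>0. \<forall>(T0 :: real \<Rightarrow> real) (s0 :: real) (H :: real)
             (T :: real \<Rightarrow> real \<Rightarrow> real) (s :: real \<Rightarrow> real).
           s0 > 0 \<longrightarrow>
           compatible_init c \<alpha> \<beta> Tm sr T0 s0 \<longrightarrow>
           H > 0 \<longrightarrow>
           (\<forall>x\<in>{0..s0}. 0 \<le> T0 x - Tm \<and> T0 x - Tm \<le> H * (s0 - x)) \<longrightarrow>
           sr > s0 + Cp / dH * integral {0..s0} (\<lambda>x. T0 x - Tm) \<longrightarrow>
           closed_loop_solution c k \<alpha> \<beta> Tm sr T0 s0 T s \<longrightarrow>
           (\<forall>t\<ge>0. H1_norm_sq Tm (s t) (\<lambda>x. T x t) + (s t - sr)\<^sup>2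
                  \<le> D * (H1_norm_sq Tm s0 T0 + (s0 - sr)\<^sup>2) * exp (- b * t))"
proof -
  have \<alpha>: "0 < \<alpha>" and \<beta>: "0 < \<beta>" using assms by auto
  have bound: "H1_norm_sq Tm (s t) (\<lambda>x. T x t) + (s t - sr)\<^sup>2
      \<le> overshoot \<alpha> \<beta> c sr * (H1_norm_sq Tm s0 T0 + (s0 - sr)\<^sup>2) * exp (- decay_rate \<alpha> c sr * t) \<and> 0 < sr"
    if init: "\<forall>x\<in>{0..s0}. 0 \<le> T0 x - Tm \<and> T0 x - Tm \<le> H * (s0 - x)"
      and setpoint: "sr > s0 + Cp / dH * integral {0..s0} (\<lambda>x. T0 x - Tm)"
      and sol: "closed_loop_solution c k \<alpha> \<beta> Tm sr T0 s0 T s" and t: "0 \<le> t" for T0 s0 H T s t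
  proof -
    define U where "U = integral {0..s0} (\<lambda>x. T0 x - Tm)"
    \<comment> \<open>Since \<open>\<beta> / \<alpha> = Cp / dH\<close>, the condition on the
      setpoint says that the initial energy is negative.\<close>
    have "1 / \<alpha> * U + 1 / \<beta> * (s0 - sr) = 1 / \<beta> * (s0 + Cp / dH * U - sr)"
      unfolding assms(5,6) using assms(1-4) by (simp add: field_simps)
    also have "\<dots> < 0" using setpoint \<beta> by (simp add: U_def divide_less_0_iff)
    finally obtain s' Tt where "stefan_loop \<alpha> \<beta> c sr s s' (\<lambda>x t. T x t - Tm) (\<lambda>x t. dx (s t) (\<lambda>y. T y t) x) Tt"
      using stefan_loop_of_solution[OF assms(1) \<alpha> \<beta> assms(7) _ _ sol, of H] init unfolding U_def by blast
    then interpret L: stefan_loop \<alpha> \<beta> c sr s s' "\<lambda>x t. T x t - Tm" "\<lambda>x t. dx (s t) (\<lambda>y. T y t) x" Tt .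
    have norm: "H1_norm_sq Tm (s t) (\<lambda>x. T x t) = L.L2_sq t + L.grad_sq t" for t
      by (simp add: H1_norm_sq_def L.L2_sq_def L.grad_sq_def)
    have s0: "s 0 = s0" "\<And>x. x \<in> {0..s0} \<Longrightarrow> T x 0 = T0 x" using sol by (auto simp: closed_loop_solution_def)
    have "H1_norm_sq Tm s0 T0 = H1_norm_sq Tm (s 0) (\<lambda>x. T x 0)"
    proof -
      have "integral {0..s0} (\<lambda>x. (T0 x - Tm)\<^sup>2) = integral {0..s0} (\<lambda>x. (T x 0 - Tm)\<^sup>2)"
        by (rule integral_cong) (simp add: s0(2))
      moreover have "integral {0..s0} (\<lambda>x. (dx s0 T0 x)\<^sup>2) = integral {0..s0} (\<lambda>x. (dx s0 (\<lambda>x. T x 0) x)\<^sup>2)"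
      proof (rule integral_cong)
        fix x assume "x \<in> {0..s0}"
        then have "dx s0 T0 x = dx s0 (\<lambda>x. T x 0) x" by (intro dx_cong) (auto simp: s0(2))
        then show "(dx s0 T0 x)\<^sup>2 = (dx s0 (\<lambda>x. T x 0) x)\<^sup>2" by simp
      qed
      ultimately show ?thesis by (simp add: H1_norm_sq_def s0(1))
    qed
    with L.exponential_decay[OF t] L.sr_pos show ?thesis by (simp add: norm norm[of 0, unfolded s0(1)] s0(1))
  qed
  show ?thesis
  \<comment> \<open>The constants must be fixed before the initial data, and their positivity is
    known for \<open>0 < sr\<close> only. Any admissible solution forces \<open>0 < sr\<close>, so
    otherwise the claim is vacuous and arbitrary constants serve.\<close>
  proof (cases "0 < sr")
    case True
    show ?thesis
      by (rule exI[of _ "overshoot \<alpha> \<beta> c sr"], rule conjI, rule overshoot_pos[OF \<alpha> \<beta> assms(7) True],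
        rule exI[of _ "decay_rate \<alpha> c sr"], rule conjI, rule decay_rate_pos[OF \<alpha> assms(7) True],
        intro allI impI, rule bound[THEN conjunct1])
  next
    case False
    show ?thesis
      by (rule exI[of _ 1], rule conjI, rule zero_less_one, rule exI[of _ 1], rule conjI, rule zero_less_one,
        intro allI impI, rule notE[OF False], rule bound[THEN conjunct2])
  qed
qed

end
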